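(* The dynamic safety problem is undecidable. This holds even when restricted to dynamic network games $(G,R)$ in which every rule of $R$ is a weak creation rule, a movement rule, or a relabeling rule (relabeling rules may perform several relabelings in one turn).
   Context: A network is a tuple $G=(V,E,A,S,(P_a)_{a\in\Sigma})$ where $V$ is a finite set of nodes, $E$ is an undirected edge relation on $V$, $A\subseteq V$ is the set of active nodes, $S\subseteq A$ is the set of strong nodes, and $(P_a)_{a\in\Sigma}$ is a partition of $V$ indexed by a finite label alphabet $\Sigma$ (a node in $P_a$ carries label $a$). Nodes in $V\setminus A$ are called deactivated (deleted); nodes in $A\setminus S$ are called weak. A network is connected if the subgraph induced by $A$ is connected. A dynamic network game is a pair $(G,R)$ of an initial network $G$ and a finite set $R$ of rules for Constructor. Destructor and Constructor move in alternation, Destructor first, and each may skip. A Destructor move deletes one weak node $v$ (i.e. $A:=A\setminus\{v\}$). A Constructor move applies one rule of $R$: - Relabeling rule $\langle a,b\longrightarrow c,d\rangle$: for active adjacent nodes $u\in P_a$, $v\in P_b$ with $(u,v)\in E$, relabel $u$ with $c$ and $v$ with $d$. A rule $\langle a,b\longrightarrow c,d\,;\,e,f\longrightarrow g,h\rangle$ (and similarly with more parts) performs several such relabelings one after another in the same turn. - Movement rule $\langle a\xrightarrow{\text{move}} b\rangle$: for $u\in S\cap P_a$ and $v\in P_b\setminus S$ with $(u,v)\in E$, set $S:=(S\setminus\{u\})\cup\{v\}$ and $A:=A\cup\{v\}$ (if $v$ was deleted, it is restored). This is called shifting the strongness from $u$ to $v$. - Creation rule $\langle a_1,\dots,a_n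 \xrightarrow{\text{create}(c)} a'_1,\dots,a'_n\rangle$: choose $n$ distinct strong nodes $u_1,\dots,u_n$ with $u_i$ labeled $a_i$; add a new node $w\notin V$ to $V$ and $A$, label it $c$, add edges between $w$ and each $u_i$, and relabel each $u_i$ with $a'_i$. Such a rule is a weak creation rule ($w$ is not strong). A strong creation rule is the same except that additionally $w$ is added to $S$. A play is an infinite sequence $G_1G_2\cdots$ with $G_1$ the initial network, where $G_{i+1}$ arises from $G_i$ by a Destructor move (or skip) if $i$ is odd and by a Constructor move (or skip) if $i$ is even. Strategies map play prefixes to the next network. In the safety game the initial network is connected and Constructor wins a play if every network in it is connected; in the reachability game the initial network is disconnected and Constructor wins a play if some network in it is connected. Constructor wins the game if she has a strategy that wins every play consistent with it; otherwise Destructor wins. The dynamic safety (resp. reachability) problem asks, given $(G,R)$, whether Constructor wins the safety (resp. reachability) game. *)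

theory Defs
  imports Main "HOL-Library.Nat_Bijection"
begin

section \<open>Computability: counter (Minsky register) machines\<close>

datatype instr = Inc nat nat        (* increment register k, goto l *)
               | Dec nat nat nat    (* if register k = 0 goto l2, else decrement and goto l1 *)

type_synonym cm_prog = "instr list"
type_synonym cm_config = "nat \<times> (nat \<Rightarrow> nat)"

fun cm_step :: "cm_prog \<Rightarrow> cm_config \<Rightarrow> cm_config" where
  "cm_step P (pc, r) =
     (if pc < length P then
        (case P ! pc of
           Inc k l \<Rightarrow> (l, r(k := Suc (r k)))
         | Dec k l1 l2 \<Rightarrow> (if r k = 0 then (l2, r) else (l1, r(k := r k - 1))))
      else (pc, r))"

definition cm_run :: "cm_prog \<Rightarrow> nat \<Rightarrow> cm_config \<Rightarrow> cm_config" where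
  "cm_run P t = (cm_step P ^^ t)"

definition cm_halted :: "cm_prog \<Rightarrow> cm_config \<Rightarrow> bool" where
  "cm_halted P c \<longleftrightarrow> length P \<le> fst c"

definition cm_init :: "nat \<Rightarrow> cm_config" where
  "cm_init x = (0, (\<lambda>_. 0)(0 := x))"

text \<open>Machine P, started with input x in register 0 (all others 0), halts and
  register 0 then holds 1 if b holds and 0 otherwise.\<close>
definition cm_answers :: "cm_prog \<Rightarrow> nat \<Rightarrow> bool \<Rightarrow> bool" where
  "cm_answers P x b \<longleftrightarrow>
     (\<exists>t. cm_halted P (cm_run P t (cm_init x)) \<and>
          snd (cm_run P t (cm_init x)) 0 = (if b then 1 else 0))"

section \<open>Networks\<close>

text \<open>Nodes and labels are natural numbers; the partition (P_a) is given by the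
  labelling function lab (node v carries label lab v).\<close>
record network =
  nodes  :: "nat set"
  edges  :: "(nat \<times> nat) set"
  active :: "nat set"
  strong :: "nat set"
  lab    :: "nat \<Rightarrow> nat"

definition wf_network :: "network \<Rightarrow> bool" where
  "wf_network G \<longleftrightarrow>
     finite (nodes G) \<and> edges G \<subseteq> nodes G \<times> nodes G \<and>
     (\<forall>u v. (u, v) \<in> edges G \<longrightarrow> (v, u) \<in> edges G) \<and>
     (\<forall>u. (u, u) \<notin> edges G) \<and>
     active G \<subseteq> nodes G \<and> strong G \<subseteq> active G \<and>
     (\<forall>v. v \<notin> nodes G \<longrightarrow> lab G v = 0)"

definition net_connected :: "network \<Rightarrow> bool" where
  "net_connected G \<longleftrightarrow>
     (\<forall>u\<in>active G. \<forall>v\<in>active G. (u, v) \<in> (edges G \<inter> active G \<times> active G)\<^sup>*)"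

section \<open>Rules\<close>

datatype rule =
    Relabel "(nat \<times> nat \<times> nat \<times> nat) list"
      (* <a1,b1 --> c1,d1 ; a2,b2 --> c2,d2 ; ...> *)
  | Move nat nat
      (* <a --move--> b> *)
  | Create bool "(nat \<times> nat) list" nat
      (* Create strong [(a1,a1'),...,(an,an')] c ; strong = True: strong creation rule *)

definition relabel1 :: "network \<Rightarrow> nat \<times> nat \<times> nat \<times> nat \<Rightarrow> network \<Rightarrow> bool" where
  "relabel1 G p G' \<longleftrightarrow> (case p of (a, b, c, d) \<Rightarrow>
     (\<exists>u v. u \<in> active G \<and> v \<in> active G \<and> (u, v) \<in> edges G \<and>
            lab G u = a \<and> lab G v = b \<and>
            G' = G\<lparr>lab := ((lab G)(u := c))(v := d)\<rparr>))"

fun relabels :: "network \<Rightarrow> (nat \<times> nat \<times> nat \<times> nat) list \<Rightarrow> network \<Rightarrow> bool" where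
  "relabels G [] G' \<longleftrightarrow> G' = G"
| "relabels G (p # ps) G'' \<longleftrightarrow> (\<exists>G'. relabel1 G p G' \<and> relabels G' ps G'')"

definition move_step :: "network \<Rightarrow> nat \<Rightarrow> nat \<Rightarrow> network \<Rightarrow> bool" where
  "move_step G a b G' \<longleftrightarrow>
     (\<exists>u v. u \<in> strong G \<and> lab G u = a \<and> v \<in> nodes G \<and> v \<notin> strong G \<and> lab G v = b \<and>
            (u, v) \<in> edges G \<and>
            G' = G\<lparr>strong := (strong G - {u}) \<union> {v}, active := active G \<union> {v}\<rparr>)"

definition create_step :: "network \<Rightarrow> bool \<Rightarrow> (nat \<times> nat) list \<Rightarrow> nat \<Rightarrow> network \<Rightarrow> bool" where
  "create_step G st ps c G' \<longleftrightarrow>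
     (\<exists>us w. length us = length ps \<and> distinct us \<and>
        (\<forall>i<length ps. us ! i \<in> strong G \<and> lab G (us ! i) = fst (ps ! i)) \<and>
        w \<notin> nodes G \<and>
        G' = \<lparr>nodes = insert w (nodes G),
              edges = edges G \<union> {(w, u) | u. u \<in> set us} \<union> {(u, w) | u. u \<in> set us},
              active = insert w (active G),
              strong = (if st then insert w (strong G) else strong G),
              lab = (foldr (\<lambda>(u, a') f. f(u := a')) (zip us (map snd ps)) (lab G))(w := c)\<rparr>)"

fun apply_rule :: "rule \<Rightarrow> network \<Rightarrow> network \<Rightarrow> bool" where
  "apply_rule (Relabel ps) G G' = relabels G ps G'"
| "apply_rule (Move a b) G G' = move_step G a b G'"
| "apply_rule (Create st ps c) G G' = create_step G st ps c G'"

fun is_strong_creation :: "rule \<Rightarrow> bool" where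
  "is_strong_creation (Create st ps c) = st"
| "is_strong_creation _ = False"

section \<open>The game\<close>

text \<open>Destructor moves (including skip).\<close>
definition destructor_moves :: "network \<Rightarrow> network set" where
  "destructor_moves G = insert G {G\<lparr>active := active G - {v}\<rparr> | v. v \<in> active G - strong G}"

text \<open>Constructor moves (including skip).\<close>
definition constructor_moves :: "rule list \<Rightarrow> network \<Rightarrow> network set" where
  "constructor_moves R G = insert G {G'. \<exists>r\<in>set R. apply_rule r G G'}"

text \<open>Plays are indexed from 0: p 0 = G_1; the move from p i to p (Suc i) is
  Destructor's if i is even and Constructor's if i is odd. A Constructor strategy
  maps the play prefix [p 0, ..., p i] to p (Suc i); it must produce legal moves on
  every play consistent with it. Constructor wins the safety game if some strategy
  keeps every network of every consistent play connected.\<close>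
definition constructor_wins_safety :: "network \<Rightarrow> rule list \<Rightarrow> bool" where
  "constructor_wins_safety G R \<longleftrightarrow>
     (\<exists>\<sigma> :: network list \<Rightarrow> network. \<forall>p :: nat \<Rightarrow> network.
        (p 0 = G \<and>
         (\<forall>i. even i \<longrightarrow> p (Suc i) \<in> destructor_moves (p i)) \<and>
         (\<forall>i. odd i \<longrightarrow> p (Suc i) = \<sigma> (map p [0..<Suc i])))
        \<longrightarrow> (\<forall>i. odd i \<longrightarrow> p (Suc i) \<in> constructor_moves R (p i)) \<and>
            (\<forall>i. net_connected (p i)))"

definition safety_instance :: "network \<Rightarrow> rule list \<Rightarrow> bool" where
  "safety_instance G R \<longleftrightarrow> wf_network G \<and> net_connected G"

section \<open>Encoding of instances as natural numbers\<close>

definition encode_network :: "network \<Rightarrow> nat" where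
  "encode_network G = list_encode
     [set_encode (nodes G), set_encode (prod_encode ` edges G),
      set_encode (active G), set_encode (strong G),
      set_encode ((\<lambda>v. prod_encode (v, lab G v)) ` nodes G)]"

fun encode_rule :: "rule \<Rightarrow> nat" where
  "encode_rule (Relabel ps) =
     prod_encode (0, list_encode (map (\<lambda>(a, b, c, d). list_encode [a, b, c, d]) ps))"
| "encode_rule (Move a b) = prod_encode (1, prod_encode (a, b))"
| "encode_rule (Create st ps c) =
     prod_encode (if st then 3 else 2, prod_encode (list_encode (map prod_encode ps), c))"

definition encode_instance :: "network \<Rightarrow> rule list \<Rightarrow> nat" where
  "encode_instance G R = prod_encode (encode_network G, list_encode (map encode_rule R))"

end

theory Submission
  imports Defs "HOL-Library.Countable"
begin

text \<open>
  A counter machine with registers \<open>c < k\<close> is turned into a game in which Constructor wins iff the machine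
  runs forever. All nodes are adjacent to a strong hub except for finitely many strong \<^emph>\<open>satellites\<close>, and
  every weak node is adjacent to at most one satellite. Hence the network is connected iff every
  satellite has an active neighbour. Constructor keeps two active neighbours at every satellite;
  whenever Destructor deletes one, she must replace it at once, by creating a neighbour or by moving
  the strength of some node onto a deleted neighbour. Destructor keeps the number at two, so that
  every deletion is a threat which dictates Constructor's reply.

  The control state is the label of the hub. Attacking the satellite \<open>Clock\<close> forces the
  creation rule that advances the control. The value of register \<open>c\<close> is the level of a strong token walking on cells
  that alternate between the satellites \<open>Parity c 0\<close> and \<open>Parity c 1\<close>. If the token has to change its level, no
  creation rule serves the satellite of the opposite parity, so attacking it forces a move. Moving onto an
  active cell replaces nothing, and Destructor can protect one cell by deleting others.
  Therefore each cell also has a dummy child (which has a dummy child in turn, and so on): among the intended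
  target and the dummy, one is deleted and can be entered. Entering a dummy only delays:
  Destructor keeps the dummy active once the token has come back from it, and then the dummy is useless.

  Given a machine \<open>M\<close> deciding the problem, let \<open>D\<close> read \<open>4 * x\<close>, compute the code of the instance consisting of
  the initial network for input \<open>x\<close> and the rule list with code \<open>x\<close>, and halt iff \<open>M\<close> answers 1. For
  \<open>x\<close> the code of the rules of \<open>D\<close> itself, \<open>M\<close> is wrong. The initial network depends on the number of registers
  but not on the rules, so \<open>D\<close> need not contain its own code.
\<close>

section \<open>Programming counter machines\<close>

datatype com = INC nat | DEC nat | SEQ com com (infixr \<open>;;\<close> 60) | LOOP nat com

inductive exec :: "com \<Rightarrow> (nat \<Rightarrow> nat) \<Rightarrow> (nat \<Rightarrow> nat) \<Rightarrow> bool" where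
  exec_INC: "exec (INC r) s (s(r := Suc (s r)))"
| exec_DEC: "exec (DEC r) s (s(r := s r - 1))"
| exec_SEQ: "exec c1 s s' \<Longrightarrow> exec c2 s' s'' \<Longrightarrow> exec (c1 ;; c2) s s''"
| exec_LOOP_0: "s r = 0 \<Longrightarrow> exec (LOOP r c) s s"
| exec_LOOP_Suc: "s r \<noteq> 0 \<Longrightarrow> exec c (s(r := s r - 1)) s' \<Longrightarrow> exec (LOOP r c) s' s'' \<Longrightarrow> exec (LOOP r c) s s''"

lemma exec_eq: "exec c s t \<Longrightarrow> t = t' \<Longrightarrow> exec c s t'"
  by simp

fun com_regs :: "com \<Rightarrow> nat set" where
  "com_regs (INC r) = {r}"
| "com_regs (DEC r) = {r}"
| "com_regs (c1 ;; c2) = com_regs c1 \<union> com_regs c2"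
| "com_regs (LOOP r c) = insert r (com_regs c)"

subsection \<open>Compilation\<close>

fun com_len :: "com \<Rightarrow> nat" where
  "com_len (INC r) = 1"
| "com_len (DEC r) = 1"
| "com_len (c1 ;; c2) = com_len c1 + com_len c2"
| "com_len (LOOP r c) = Suc (com_len c)"

text \<open>Code placed at address \<open>p\<close> that jumps to \<open>e\<close> when it is done.\<close>
fun com_code :: "com \<Rightarrow> nat \<Rightarrow> nat \<Rightarrow> instr list" where
  "com_code (INC r) p e = [Inc r e]"
| "com_code (DEC r) p e = [Dec r e e]"
| "com_code (c1 ;; c2) p e = com_code c1 p (p + com_len c1) @ com_code c2 (p + com_len c1) e"
| "com_code (LOOP r c) p e = Dec r (Suc p) e # com_code c (Suc p) p"

lemma length_com_code [simp]: "length (com_code c p e) = com_len c"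
  by (induction c arbitrary: p e) auto

fun instr_reg :: "instr \<Rightarrow> nat" where
  "instr_reg (Inc r l) = r"
| "instr_reg (Dec r l l') = r"

lemma instr_reg_com_code: "instr_reg ` set (com_code c p e) = com_regs c"
  by (induction c arbitrary: p e) (auto simp: image_Un)

definition embedded :: "instr list \<Rightarrow> nat \<Rightarrow> cm_prog \<Rightarrow> bool" where
  "embedded cs p P \<longleftrightarrow> (\<exists>xs ys. P = xs @ cs @ ys \<and> length xs = p)"

lemma embedded_middle: "embedded cs (length xs) (xs @ cs @ ys)"
  by (auto simp: embedded_def)

lemma embedded_appendD:
  assumes "embedded (cs @ ds) p P"
  shows "embedded cs p P" "embedded ds (p + length cs) P"
proof -
  obtain xs ys where split: "P = xs @ (cs @ ds) @ ys" and length: "length xs = p"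
    using assms by (auto simp: embedded_def)
  have "P = xs @ cs @ (ds @ ys)" "P = (xs @ cs) @ ds @ ys" by (simp_all add: split)
  then show "embedded cs p P" "embedded ds (p + length cs) P"
    using length unfolding embedded_def by (blast, metis length_append)
qed

lemma embedded_nth:
  assumes "embedded cs p P" "i < length cs"
  shows "p + i < length P" "P ! (p + i) = cs ! i"
  using assms by (auto simp: embedded_def nth_append)

lemma embedded_ConsD:
  assumes "embedded (i # cs) p P"
  shows "p < length P" "P ! p = i" "embedded cs (Suc p) P"
  using embedded_nth[OF assms, of 0] embedded_appendD(2)[of "[i]" cs p P] assms by simp_all

definition reaches :: "cm_prog \<Rightarrow> cm_config \<Rightarrow> cm_config \<Rightarrow> bool" where
  "reaches P c c' \<longleftrightarrow> (\<exists>t. cm_run P t c = c')"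

lemma cm_run_0 [simp]: "cm_run P 0 c = c"
  by (simp add: cm_run_def)

lemma cm_run_Suc: "cm_run P (Suc t) c = cm_run P t (cm_step P c)"
  by (simp add: cm_run_def funpow_Suc_right del: funpow.simps)

lemma cm_run_add: "cm_run P (t + t') c = cm_run P t' (cm_run P t c)"
  by (induction t arbitrary: c) (auto simp: cm_run_Suc)

lemma reaches_refl: "reaches P c c"
  unfolding reaches_def by (rule exI[of _ 0]) simp

lemma reaches_trans [trans]: "reaches P c c' \<Longrightarrow> reaches P c' c'' \<Longrightarrow> reaches P c c''"
  unfolding reaches_def by (metis cm_run_add)

lemma reaches_step: "reaches P (cm_step P c) c' \<Longrightarrow> reaches P c c'"
  unfolding reaches_def by (metis cm_run_Suc)

lemma reaches_com_code:
  "exec c s s' \<Longrightarrow> embedded (com_code c p e) p P \<Longrightarrow> reaches P (p, s) (e, s')"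
proof (induction arbitrary: p e rule: exec.induct)
  case (exec_INC r s)
  then have "cm_step P (p, s) = (e, s(r := Suc (s r)))"
    by (auto dest: embedded_ConsD)
  then show ?case by (metis reaches_step reaches_refl)
next
  case (exec_DEC r s)
  then have "cm_step P (p, s) = (e, s(r := s r - 1))"
    by (auto dest: embedded_ConsD simp: fun_eq_iff)
  then show ?case by (metis reaches_step reaches_refl)
next
  case (exec_SEQ c1 s s' c2 s'')
  note embedded = embedded_appendD[OF exec_SEQ.prems[unfolded com_code.simps]]
  show ?case
    using exec_SEQ.IH(1)[OF embedded(1)] exec_SEQ.IH(2)[of "p + com_len c1" e] embedded(2)
    by (auto intro: reaches_trans)
next
  case (exec_LOOP_0 s r c)
  then have "cm_step P (p, s) = (e, s)"
    by (auto dest: embedded_ConsD)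
  then show ?case by (metis reaches_step reaches_refl)
next
  case (exec_LOOP_Suc s r c s' s'')
  note embedded = embedded_ConsD[OF exec_LOOP_Suc.prems[unfolded com_code.simps]]
  have "cm_step P (p, s) = (Suc p, s(r := s r - 1))"
    using embedded exec_LOOP_Suc.hyps(1) by simp
  moreover have "reaches P (Suc p, s(r := s r - 1)) (p, s')"
    using exec_LOOP_Suc.IH(1)[OF embedded(3)] .
  moreover have "reaches P (p, s') (e, s'')"
    using exec_LOOP_Suc.IH(2)[OF exec_LOOP_Suc.prems] .
  ultimately show ?case by (metis reaches_step reaches_trans)
qed

definition halts :: "cm_prog \<Rightarrow> cm_config \<Rightarrow> bool" where
  "halts P c \<longleftrightarrow> (\<exists>t. cm_halted P (cm_run P t c))"

lemma halts_step: "halts P (cm_step P c) \<longleftrightarrow> halts P c"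
proof
  assume "halts P c"
  then obtain t where halted: "cm_halted P (cm_run P t c)"
    by (auto simp: halts_def)
  have "cm_step P c = c" if "cm_halted P c"
    using that by (cases c) (simp add: cm_halted_def)
  then show "halts P (cm_step P c)"
    using halted unfolding halts_def by (cases t) (metis cm_run_0, metis cm_run_Suc)
qed (auto simp: halts_def cm_run_Suc[symmetric])

lemma halts_reaches:
  assumes "reaches P c c'"
  shows "halts P c \<longleftrightarrow> halts P c'"
proof -
  have "halts P (cm_run P t c) \<longleftrightarrow> halts P c" for t
    by (induction t arbitrary: c) (auto simp: cm_run_Suc halts_step)
  then show ?thesis
    using assms by (auto simp: reaches_def)
qed

subsection \<open>Arithmetic\<close>

text \<open>The family \<open>f\<close> is the loop invariant, indexed by the number of remaining iterations.\<close>
lemma exec_LOOP_countdown: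
  assumes "f (s r) = s" and count: "\<And>i. f i r = i"
    and body: "\<And>i. i < s r \<Longrightarrow> exec c ((f (Suc i))(r := i)) (f i)" and "f 0 = t"
  shows "exec (LOOP r c) s t"
proof -
  have "exec (LOOP r c) (f n) (f 0)" if "n \<le> s r" for n
    using that
  proof (induction n)
    case 0
    show ?case by (simp add: count exec_LOOP_0)
  next
    case (Suc n)
    then have "exec c ((f (Suc n))(r := n)) (f n)" "exec (LOOP r c) (f n) (f 0)"
      by (auto intro: body)
    then show ?case
      using exec_LOOP_Suc[of "f (Suc n)" r c "f n" "f 0"] by (simp add: count)
  qed
  then show ?thesis using assms(1,4) by (metis order_refl)
qed

definition MOVE :: "nat \<Rightarrow> nat \<Rightarrow> com" where
  "MOVE r d = LOOP r (INC d)"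

lemma exec_MOVE:
  assumes "r \<noteq> d"
  shows "exec (MOVE r d) s (s(r := 0, d := s d + s r))"
  unfolding MOVE_def
  by (rule exec_LOOP_countdown[where f = "\<lambda>i. s(r := i, d := s d + (s r - i))"])
    (use assms in \<open>auto intro!: exec_eq[OF exec_INC] simp: fun_eq_iff\<close>)

definition CLEAR :: "nat \<Rightarrow> nat \<Rightarrow> com" where
  "CLEAR r z = LOOP r (DEC z)"

lemma exec_CLEAR:
  assumes "r \<noteq> z" "s z = 0"
  shows "exec (CLEAR r z) s (s(r := 0))"
  unfolding CLEAR_def
  by (rule exec_LOOP_countdown[where f = "\<lambda>i. s(r := i)"])
    (use assms in \<open>auto intro!: exec_eq[OF exec_DEC] simp: fun_eq_iff\<close>)

definition COPY :: "nat \<Rightarrow> nat \<Rightarrow> nat \<Rightarrow> com" where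
  "COPY r d t = LOOP r (INC d ;; INC t) ;; MOVE t r"

lemma exec_COPY:
  assumes "r \<noteq> d" "r \<noteq> t" "d \<noteq> t" "s t = 0"
  shows "exec (COPY r d t) s (s(d := s d + s r))"
  unfolding COPY_def
proof (rule exec_SEQ)
  show "exec (LOOP r (INC d ;; INC t)) s (s(r := 0, d := s d + s r, t := s r))"
    by (rule exec_LOOP_countdown[where f = "\<lambda>i. s(r := i, d := s d + (s r - i), t := s r - i)"])
      (use assms in \<open>auto intro!: exec_eq[OF exec_SEQ[OF exec_INC exec_INC]] simp: fun_eq_iff\<close>)
  show "exec (MOVE t r) (s(r := 0, d := s d + s r, t := s r)) (s(d := s d + s r))"
    by (rule exec_eq[OF exec_MOVE]) (use assms in \<open>auto simp: fun_eq_iff\<close>)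
qed

definition DOUBLE :: "nat \<Rightarrow> nat \<Rightarrow> com" where
  "DOUBLE d t = LOOP d (INC t ;; INC t) ;; MOVE t d"

lemma exec_DOUBLE:
  assumes "d \<noteq> t" "s t = 0"
  shows "exec (DOUBLE d t) s (s(d := 2 * s d))"
  unfolding DOUBLE_def
proof (rule exec_SEQ)
  show "exec (LOOP d (INC t ;; INC t)) s (s(d := 0, t := 2 * s d))"
    by (rule exec_LOOP_countdown[where f = "\<lambda>i. s(d := i, t := 2 * (s d - i))"])
      (use assms in \<open>auto intro!: exec_eq[OF exec_SEQ[OF exec_INC exec_INC]] simp: fun_eq_iff\<close>)
  show "exec (MOVE t d) (s(d := 0, t := 2 * s d)) (s(d := 2 * s d))"
    by (rule exec_eq[OF exec_MOVE]) (use assms in \<open>auto simp: fun_eq_iff\<close>)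
qed

definition POWER :: "nat \<Rightarrow> nat \<Rightarrow> nat \<Rightarrow> com" where
  "POWER r d t = INC d ;; LOOP r (DOUBLE d t)"

lemma exec_POWER:
  assumes "s d = 0" "s t = 0" "d \<noteq> r" "t \<noteq> r" "d \<noteq> t"
  shows "exec (POWER r d t) s (s(r := 0, d := 2 ^ s r))"
  unfolding POWER_def
proof (rule exec_SEQ)
  show "exec (INC d) s (s(d := 1))"
    by (rule exec_eq[OF exec_INC]) (simp add: assms)
  have "exec (DOUBLE d t) ((s(r := Suc i, d := 2 ^ (s r - Suc i)))(r := i)) (s(r := i, d := 2 ^ (s r - i)))"
    if "i < s r" for i
  proof -
    have "2 * 2 ^ (s r - Suc i) = (2::nat) ^ (s r - i)"
      using that by (simp flip: power_Suc add: Suc_diff_Suc)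
    then show ?thesis
      using assms by (intro exec_eq[OF exec_DOUBLE]) (auto simp: fun_eq_iff)
  qed
  then show "exec (LOOP r (DOUBLE d t)) (s(d := 1)) (s(r := 0, d := 2 ^ s r))"
    by (intro exec_LOOP_countdown[where f = "\<lambda>i. s(r := i, d := 2 ^ (s r - i))"])
      (use assms in \<open>auto simp: fun_eq_iff\<close>)
qed

definition TRIANGLE :: "nat \<Rightarrow> nat \<Rightarrow> nat \<Rightarrow> com" where
  "TRIANGLE r d t = LOOP r (COPY r d t ;; INC d)"

lemma exec_TRIANGLE:
  assumes "s d = 0" "s t = 0" "d \<noteq> r" "t \<noteq> r" "d \<noteq> t"
  shows "exec (TRIANGLE r d t) s (s(r := 0, d := triangle (s r)))"
  unfolding TRIANGLE_def
proof (rule exec_LOOP_countdown[where f = "\<lambda>i. s(r := i, d := triangle (s r) - triangle i)"])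
  fix i assume less: "i < s r"
  have "exec (COPY r d t) ((s(r := Suc i, d := triangle (s r) - triangle (Suc i)))(r := i))
      (s(r := i, d := triangle (s r) - triangle (Suc i) + i))"
    using assms by (intro exec_eq[OF exec_COPY]) (auto simp: fun_eq_iff)
  moreover have "exec (INC d) (s(r := i, d := triangle (s r) - triangle (Suc i) + i))
      (s(r := i, d := triangle (s r) - triangle i))"
  proof -
    have "triangle (Suc i) \<le> triangle (s r)"
      by (rule lift_Suc_mono_le[of triangle]) (use less in simp_all)
    then show ?thesis
      using assms by (intro exec_eq[OF exec_INC]) (simp add: fun_eq_iff)
  qed
  ultimately show "exec (COPY r d t ;; INC d) ((s(r := Suc i, d := triangle (s r) - triangle (Suc i)))(r := i))
      (s(r := i, d := triangle (s r) - triangle i))"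
    by (rule exec_SEQ)
qed (use assms in \<open>auto simp: fun_eq_iff\<close>)

subsection \<open>Expressions\<close>

datatype exp = Const nat | Input | Index | Add exp exp | Triangle exp | Pow2 exp | Sum exp

fun eval :: "exp \<Rightarrow> nat \<Rightarrow> nat \<Rightarrow> nat" where
  "eval (Const n) x j = n"
| "eval Input x j = x"
| "eval Index x j = j"
| "eval (Add a b) x j = eval a x j + eval b x j"
| "eval (Triangle a) x j = triangle (eval a x j)"
| "eval (Pow2 a) x j = 2 ^ eval a x j"
| "eval (Sum a) x j = (\<Sum>i<x. eval a x i)"

fun const_code :: "nat \<Rightarrow> nat \<Rightarrow> com" where
  "const_code 0 d = DEC d"
| "const_code (Suc n) d = const_code n d ;; INC d"

text \<open>The input is in register 0, the index in register \<open>i\<close>; the registers from \<open>d\<close> on are free, and \<open>d\<close> receives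
  the value.\<close>
fun exp_code :: "exp \<Rightarrow> nat \<Rightarrow> nat \<Rightarrow> com" where
  "exp_code (Const n) i d = const_code n d"
| "exp_code Input i d = COPY 0 d (Suc d)"
| "exp_code Index i d = COPY i d (Suc d)"
| "exp_code (Add a b) i d = exp_code a i d ;; exp_code b i (Suc d) ;; MOVE (Suc d) d"
| "exp_code (Triangle a) i d = exp_code a i (Suc d) ;; TRIANGLE (Suc d) d (Suc (Suc d))"
| "exp_code (Pow2 a) i d = exp_code a i (Suc d) ;; POWER (Suc d) d (Suc (Suc d))"
| "exp_code (Sum a) i d = COPY 0 (Suc d) d ;;
     LOOP (Suc d) (exp_code a (Suc d) (Suc (Suc d)) ;; MOVE (Suc (Suc d)) d)"

fun exp_regs :: "exp \<Rightarrow> nat" where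
  "exp_regs (Const n) = 1"
| "exp_regs Input = 2"
| "exp_regs Index = 2"
| "exp_regs (Add a b) = Suc (max (exp_regs a) (exp_regs b))"
| "exp_regs (Triangle a) = 2 + exp_regs a"
| "exp_regs (Pow2 a) = 2 + exp_regs a"
| "exp_regs (Sum a) = 2 + exp_regs a"

lemmas com_defs = MOVE_def CLEAR_def COPY_def DOUBLE_def POWER_def TRIANGLE_def

lemma com_regs_exp_code:
  assumes "i < d"
  shows "com_regs (exp_code e i d) \<subseteq> {..<d + exp_regs e}"
  using assms
proof (induction e arbitrary: i d)
  case (Const n)
  show ?case by (induction n) auto
next
  case (Add a b)
  have "0 < exp_regs b" by (induction b) auto
  then show ?case using Add.IH(1)[of i d] Add.IH(2)[of i "Suc d"] Add.prems by (auto simp: com_defs)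
next
  case (Triangle a)
  have "0 < exp_regs a" by (induction a) auto
  then show ?case using Triangle.IH[of i "Suc d"] Triangle.prems by (auto simp: com_defs)
next
  case (Pow2 a)
  have "0 < exp_regs a" by (induction a) auto
  then show ?case using Pow2.IH[of i "Suc d"] Pow2.prems by (auto simp: com_defs)
next
  case (Sum a)
  have "0 < exp_regs a" by (induction a) auto
  then show ?case using Sum.IH[of "Suc d" "Suc (Suc d)"] by (auto simp: com_defs)
qed (auto simp: com_defs)

lemma exec_const_code: "s d = 0 \<Longrightarrow> exec (const_code n d) s (s(d := n))"
proof (induction n)
  case 0
  then show ?case by (auto intro!: exec_eq[OF exec_DEC] simp: fun_eq_iff)
next
  case (Suc n)
  then show ?case unfolding const_code.simps
    by (intro exec_eq[OF exec_SEQ[OF Suc.IH exec_INC]]) (simp_all add: fun_eq_iff)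
qed

lemma exec_exp_code_Sum:
  assumes "0 < d" "\<And>r. d \<le> r \<Longrightarrow> s r = 0"
    and IH: "\<And>s. (\<And>r. Suc (Suc d) \<le> r \<Longrightarrow> s r = 0) \<Longrightarrow>
      exec (exp_code e (Suc d) (Suc (Suc d))) s (s(Suc (Suc d) := eval e (s 0) (s (Suc d))))"
  shows "exec (exp_code (Sum e) i d) s (s(d := eval (Sum e) (s 0) j))"
proof -
  let ?x = "s 0"
  let ?f = "\<lambda>n. s(Suc d := n, d := (\<Sum>m\<in>{n..<?x}. eval e ?x m))"
  have copy: "exec (COPY 0 (Suc d) d) s (s(Suc d := ?x))"
    using assms(1,2) by (intro exec_eq[OF exec_COPY]) (auto simp: fun_eq_iff)
  have loop: "exec (LOOP (Suc d) (exp_code e (Suc d) (Suc (Suc d)) ;; MOVE (Suc (Suc d)) d))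
      (s(Suc d := ?x)) (s(d := eval (Sum e) ?x j))"
  proof (rule exec_LOOP_countdown[where f = ?f])
    fix n assume less: "n < (s(Suc d := ?x)) (Suc d)"
    let ?t = "(?f (Suc n))(Suc d := n)"
    have "exec (exp_code e (Suc d) (Suc (Suc d))) ?t (?t(Suc (Suc d) := eval e ?x n))"
      using assms(1,2) by (intro exec_eq[OF IH]) auto
    moreover have "exec (MOVE (Suc (Suc d)) d) (?t(Suc (Suc d) := eval e ?x n)) (?f n)"
      using assms(2) less by (intro exec_eq[OF exec_MOVE]) (auto simp: fun_eq_iff sum.atLeast_Suc_lessThan)
    ultimately show "exec (exp_code e (Suc d) (Suc (Suc d)) ;; MOVE (Suc (Suc d)) d) ?t (?f n)"
      by (rule exec_SEQ)
  qed (use assms(2) in \<open>auto simp: fun_eq_iff lessThan_atLeast0\<close>)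
  show ?thesis unfolding exp_code.simps by (rule exec_SEQ[OF copy loop])
qed

lemma exec_exp_code:
  assumes "i < d" "\<And>r. d \<le> r \<Longrightarrow> s r = 0"
  shows "exec (exp_code e i d) s (s(d := eval e (s 0) (s i)))"
  using assms
proof (induction e arbitrary: i d s)
  case (Add a b)
  let ?u = "s(d := eval a (s 0) (s i))"
  let ?v = "?u(Suc d := eval b (s 0) (s i))"
  have left: "exec (exp_code a i d) s ?u"
    using Add.prems by (intro Add.IH(1)) auto
  have right: "exec (exp_code b i (Suc d)) ?u ?v"
    using Add.prems by (intro exec_eq[OF Add.IH(2)]) auto
  have "exec (MOVE (Suc d) d) ?v (s(d := eval (Add a b) (s 0) (s i)))"
    using Add.prems by (intro exec_eq[OF exec_MOVE]) (auto simp: fun_eq_iff)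
  then show ?case unfolding exp_code.simps by (rule exec_SEQ[OF left exec_SEQ[OF right]])
next
  case (Triangle a)
  have arg: "exec (exp_code a i (Suc d)) s (s(Suc d := eval a (s 0) (s i)))"
    using Triangle.prems by (intro Triangle.IH) auto
  have "exec (TRIANGLE (Suc d) d (Suc (Suc d))) (s(Suc d := eval a (s 0) (s i)))
      (s(d := eval (Triangle a) (s 0) (s i)))"
    using Triangle.prems by (intro exec_eq[OF exec_TRIANGLE]) (auto simp: fun_eq_iff)
  then show ?case unfolding exp_code.simps by (rule exec_SEQ[OF arg])
next
  case (Pow2 a)
  have arg: "exec (exp_code a i (Suc d)) s (s(Suc d := eval a (s 0) (s i)))"
    using Pow2.prems by (intro Pow2.IH) auto
  have "exec (POWER (Suc d) d (Suc (Suc d))) (s(Suc d := eval a (s 0) (s i)))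
      (s(d := eval (Pow2 a) (s 0) (s i)))"
    using Pow2.prems by (intro exec_eq[OF exec_POWER]) (auto simp: fun_eq_iff)
  then show ?case unfolding exp_code.simps by (rule exec_SEQ[OF arg])
next
  case (Sum a)
  show ?case
  proof (rule exec_exp_code_Sum)
    show "exec (exp_code a (Suc d) (Suc (Suc d))) s (s(Suc (Suc d) := eval a (s 0) (s (Suc d))))"
      if "\<And>r. Suc (Suc d) \<le> r \<Longrightarrow> s r = 0" for s
      using that by (intro Sum.IH) auto
  qed (use Sum.prems in auto)
qed (auto intro!: exec_const_code exec_eq[OF exec_COPY] simp: fun_eq_iff)

section \<open>The safety game as a fixed point\<close>

definition consistent_play :: "(network list \<Rightarrow> network) \<Rightarrow> network \<Rightarrow> (nat \<Rightarrow> network) \<Rightarrow> bool" where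
  "consistent_play \<sigma> G p \<longleftrightarrow> p 0 = G \<and>
     (\<forall>i. even i \<longrightarrow> p (Suc i) \<in> destructor_moves (p i)) \<and>
     (\<forall>i. odd i \<longrightarrow> p (Suc i) = \<sigma> (map p [0..<Suc i]))"

definition safe_play :: "rule list \<Rightarrow> (nat \<Rightarrow> network) \<Rightarrow> bool" where
  "safe_play R p \<longleftrightarrow> (\<forall>i. odd i \<longrightarrow> p (Suc i) \<in> constructor_moves R (p i)) \<and> (\<forall>i. net_connected (p i))"

lemma constructor_wins_safety_iff:
  "constructor_wins_safety G R \<longleftrightarrow> (\<exists>\<sigma>. \<forall>p. consistent_play \<sigma> G p \<longrightarrow> safe_play R p)"
  by (simp only: constructor_wins_safety_def consistent_play_def safe_play_def)

lemma safe_playI: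
  assumes "\<And>i. even i \<Longrightarrow> net_connected (p i) \<and> net_connected (p (Suc i)) \<and>
      p (Suc (Suc i)) \<in> constructor_moves R (p (Suc i))"
  shows "safe_play R p"
  unfolding safe_play_def
proof (intro conjI allI impI)
  show "p (Suc i) \<in> constructor_moves R (p i)" if "odd i" for i
    using assms[of "i - 1"] that by (cases i) auto
  show "net_connected (p i)" for i
    using assms[of i] assms[of "i - 1"] by (cases i) auto
qed

lemma constructor_wins_safety_coinduct:
  assumes "I G"
    and step: "\<And>G G'. I G \<Longrightarrow> G' \<in> destructor_moves G \<Longrightarrow>
       net_connected G' \<and> (\<exists>G''\<in>constructor_moves R G'. I G'')"
  shows "constructor_wins_safety G R"
proof -
  define \<sigma> where "\<sigma> h = (SOME G''. G'' \<in> constructor_moves R (last h) \<and> I G'')" for h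
  have "safe_play R p" if play: "consistent_play \<sigma> G p" for p
  proof -
    have round: "net_connected (p (Suc i)) \<and> p (Suc (Suc i)) \<in> constructor_moves R (p (Suc i)) \<and>
        I (p (Suc (Suc i)))"
      if "even i" "I (p i)" for i
    proof -
      have "p (Suc i) \<in> destructor_moves (p i)" "p (Suc (Suc i)) = \<sigma> (map p [0..<Suc (Suc i)])"
        using play \<open>even i\<close> unfolding consistent_play_def by (blast, simp)
      moreover have "last (map p [0..<Suc (Suc i)]) = p (Suc i)"
        by simp
      ultimately show ?thesis
        using step[OF \<open>I (p i)\<close>] someI_ex[of "\<lambda>G''. G'' \<in> constructor_moves R (p (Suc i)) \<and> I G''"]
        unfolding \<sigma>_def by metis
    qed
    have "I (p (2 * n))" for n
      by (induction n) (use round assms(1) play in \<open>auto simp: consistent_play_def\<close>)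
    then have inv: "I (p i)" if "even i" for i
      using that by (metis evenE)
    have "net_connected G'" if "I G'" for G'
      using step[OF that, of G'] by (simp add: destructor_moves_def)
    then show ?thesis
      using inv round by (intro safe_playI) blast
  qed
  then show ?thesis
    unfolding constructor_wins_safety_iff by blast
qed

fun skipping_play :: "(network list \<Rightarrow> network) \<Rightarrow> network \<Rightarrow> nat \<Rightarrow> network" where
  "skipping_play \<sigma> G 0 = G"
| "skipping_play \<sigma> G (Suc i) =
     (if even i then skipping_play \<sigma> G i else \<sigma> (map (\<lambda>j. skipping_play \<sigma> G j) [0..<Suc i]))"

declare skipping_play.simps(2) [simp del]

lemma consistent_skipping_play: "consistent_play \<sigma> G (skipping_play \<sigma> G)"
  by (simp add: consistent_play_def skipping_play.simps(2) destructor_moves_def del: upt_Suc)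

lemma consistent_play_Cons2:
  assumes "G' \<in> destructor_moves G" and play: "consistent_play (\<lambda>h. \<sigma> (G # G' # h)) (\<sigma> [G, G']) p"
  shows "consistent_play \<sigma> G (case_nat G (case_nat G' p))"
    (is "consistent_play \<sigma> G ?q")
  unfolding consistent_play_def
proof (intro conjI allI impI)
  show "?q (Suc i) \<in> destructor_moves (?q i)" if "even i" for i
  proof (cases i)
    case (Suc j)
    then show ?thesis using play that by (cases j) (auto simp: consistent_play_def)
  qed (use assms(1) in simp)
  show "?q (Suc i) = \<sigma> (map ?q [0..<Suc i])" if odd: "odd i" for i
  proof (cases i)
    case (Suc j)
    show ?thesis
    proof (cases j)
      case 0
      then show ?thesis using Suc play by (simp add: consistent_play_def)
    next
      case (Suc m)
      have "map ?q [0..<Suc (Suc (Suc m))] = G # G' # map p [0..<Suc m]"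
        by (simp add: map_upt_Suc del: upt_Suc)
      then show ?thesis
        using play odd \<open>i = Suc j\<close> Suc by (simp add: consistent_play_def del: upt_Suc)
    qed
  qed (use odd in simp)
qed simp

lemma constructor_wins_safety_step:
  assumes "constructor_wins_safety G R" "G' \<in> destructor_moves G"
  shows "net_connected G'" "\<exists>G''\<in>constructor_moves R G'. constructor_wins_safety G'' R"
proof -
  obtain \<sigma> where \<sigma>: "safe_play R p" if "consistent_play \<sigma> G p" for p
    using assms(1) unfolding constructor_wins_safety_iff by blast
  let ?\<tau> = "\<lambda>h. \<sigma> (G # G' # h)"
  have safe: "safe_play R (case_nat G (case_nat G' p))" if "consistent_play ?\<tau> (\<sigma> [G, G']) p" for p
    using \<sigma> consistent_play_Cons2[OF assms(2) that] .
  have after: "net_connected G' \<and> p 0 \<in> constructor_moves R G' \<and> safe_play R p"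
    if "consistent_play ?\<tau> (\<sigma> [G, G']) p" for p
  proof -
    let ?q = "case_nat G (case_nat G' p)"
    have conn: "net_connected (?q i)" and legal: "odd i \<Longrightarrow> ?q (Suc i) \<in> constructor_moves R (?q i)" for i
      using safe[OF that] by (auto simp: safe_play_def)
    have "safe_play R p"
      unfolding safe_play_def using conn[of "Suc (Suc _)"] legal[of "Suc (Suc _)"] by simp
    then show ?thesis using conn[of 1] legal[of 1] by simp
  qed
  have "skipping_play ?\<tau> (\<sigma> [G, G']) 0 = \<sigma> [G, G']"
    by simp
  then show "net_connected G'" "\<exists>G''\<in>constructor_moves R G'. constructor_wins_safety G'' R"
    using after[OF consistent_skipping_play] after unfolding constructor_wins_safety_iff by (blast, metis)
qed

abbreviation destructor_wins :: "rule list \<Rightarrow> network \<Rightarrow> bool" where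
  "destructor_wins R G \<equiv> \<not> constructor_wins_safety G R"

lemma destructor_wins_disconnected: "\<not> net_connected G \<Longrightarrow> destructor_wins R G"
  using constructor_wins_safety_step(1)[of G R G] by (auto simp: destructor_moves_def)

lemma destructor_wins_disconnecting: "G' \<in> destructor_moves G \<Longrightarrow> \<not> net_connected G' \<Longrightarrow> destructor_wins R G"
  using constructor_wins_safety_step(1) by blast

lemma destructor_wins_forcing:
  "G' \<in> destructor_moves G \<Longrightarrow> (\<And>G''. G'' \<in> constructor_moves R G' \<Longrightarrow> destructor_wins R G'') \<Longrightarrow> destructor_wins R G"
  using constructor_wins_safety_step(2) by blast

section \<open>The shape of the networks\<close>

subsection \<open>Kinds of nodes\<close>

type_synonym position = "nat \<times> nat"

datatype satellite = Clock | Parity nat nat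

text \<open>\<open>Cell c (l, d)\<close> is the cell of counter \<open>c\<close> at level \<open>l\<close> and depth \<open>d\<close> in the chain of dummies of that level.
  A connector remembers the node, besides the hub and its satellite, that it has been attached to.\<close>
datatype kind = Hub | Satellite satellite | is_Connector: Connector satellite kind | is_Cell: Cell nat position

definition satellites :: "nat \<Rightarrow> satellite list" where
  "satellites k = Clock # [Parity c j. c \<leftarrow> [0..<k], j \<leftarrow> [0, 1]]"

lemma in_satellites: "y \<in> set (satellites k) \<longleftrightarrow> y = Clock \<or> (\<exists>c j. c < k \<and> j < 2 \<and> y = Parity c j)"
  by (auto simp: satellites_def less_2_cases_iff)

definition side :: "nat \<Rightarrow> position \<Rightarrow> satellite" where
  "side c p = Parity c ((fst p + snd p) mod 2)"

definition opposite_side :: "nat \<Rightarrow> position \<Rightarrow> satellite" where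
  "opposite_side c p = Parity c (Suc (fst p + snd p) mod 2)"

fun serves :: "kind \<Rightarrow> satellite \<Rightarrow> bool" where
  "serves (Connector z t) y \<longleftrightarrow> z = y"
| "serves (Cell c p) y \<longleftrightarrow> side c p = y"
| "serves _ y \<longleftrightarrow> False"

fun is_child :: "position \<Rightarrow> position \<Rightarrow> bool" where
  "is_child (l, d) (l', d') \<longleftrightarrow> l' = l \<and> d' = Suc d \<or> d = 0 \<and> d' = 0 \<and> l' = Suc l"

definition adjacent :: "position \<Rightarrow> position \<Rightarrow> bool" where
  "adjacent p q \<longleftrightarrow> is_child p q \<or> is_child q p"

fun attached :: "kind \<Rightarrow> kind \<Rightarrow> bool" where
  "attached Hub a \<longleftrightarrow> is_Connector a \<or> is_Cell a"
| "attached (Satellite y) a \<longleftrightarrow> serves a y"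
| "attached (Cell c p) (Connector y t) \<longleftrightarrow> t = Cell c p"
| "attached (Cell c p) (Cell c' q) \<longleftrightarrow> c' = c \<and> is_child p q"
| "attached _ _ \<longleftrightarrow> False"

definition linked :: "kind \<Rightarrow> kind \<Rightarrow> bool" where
  "linked a b \<longleftrightarrow> attached a b \<or> attached b a"

lemma linked_sym: "linked a b \<longleftrightarrow> linked b a"
  by (auto simp: linked_def)

lemma is_child_irrefl: "\<not> is_child p p"
  by (cases p) auto

lemma is_child_parent_unique: "is_child p q \<Longrightarrow> is_child p' q \<Longrightarrow> p = p'"
  by (cases p; cases p'; cases q) auto

lemma linked_irrefl: "\<not> linked a a"
  by (cases a) (auto simp: linked_def is_child_irrefl)

lemma side_eq_iff: "side c p = side c' q \<longleftrightarrow> c = c' \<and> (fst p + snd p) mod 2 = (fst q + snd q) mod 2"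
  by (auto simp: side_def)

lemma side_adjacent: "adjacent p q \<Longrightarrow> side c q = opposite_side c p"
  by (cases p; cases q) (auto simp: adjacent_def side_def opposite_side_def; presburger)

lemma side_neq_opposite_side: "side c p \<noteq> opposite_side c' p"
  by (simp add: side_def opposite_side_def mod_Suc)

lemma side_mem: "c < k \<Longrightarrow> side c p \<in> set (satellites k)"
  by (simp add: side_def in_satellites)

lemma opposite_side_mem: "c < k \<Longrightarrow> opposite_side c p \<in> set (satellites k)"
  by (simp add: opposite_side_def in_satellites)

subsection \<open>Creating a cell\<close>

text \<open>The status counts the children of a cell: first the cell of the next level, then a dummy. Dummies start with
  status 1, as they have no child of the first kind.\<close>
fun status :: "kind set \<Rightarrow> nat \<Rightarrow> position \<Rightarrow> nat" where
  "status K c (l, d) =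
     (if d = 0 \<and> Cell c (Suc l, 0) \<notin> K then 0 else if Cell c (l, Suc d) \<notin> K then 1 else 2)"

fun next_child :: "kind set \<Rightarrow> nat \<Rightarrow> position \<Rightarrow> position" where
  "next_child K c (l, d) = (if status K c (l, d) = 0 then (Suc l, 0) else (l, Suc d))"

definition created :: "kind set \<Rightarrow> nat \<Rightarrow> position \<Rightarrow> satellite \<Rightarrow> kind" where
  "created K c p y = (if y = opposite_side c p \<and> status K c p < 2 then Cell c (next_child K c p)
     else Connector y (Cell c p))"

lemma status_le: "status K c p \<le> 2"
  by (cases p) (auto simp: status.simps)

declare status.simps [simp del]

lemma status_insert_Connector: "status (insert (Connector y t) K) c p = status K c p"
  by (cases p) (simp add: status.simps)

lemma next_child_props:
  shows "fst (next_child K c p) + snd (next_child K c p) = Suc (fst p + snd p)"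
    and "0 < snd (next_child K c p) \<longleftrightarrow> status K c p \<noteq> 0"
    and "next_child K c p \<noteq> (0, 0)"
  by (cases p; simp add: status.simps split: if_splits)+

lemma is_child_next_child: "is_child p (next_child K c p)"
  by (cases p) (auto simp: status.simps)

declare next_child.simps [simp del]

lemma side_next_child: "side c (next_child K c p) = opposite_side c p"
  by (rule side_adjacent) (simp add: adjacent_def is_child_next_child)

lemma serves_created: "serves (created K c p y) z \<longleftrightarrow> z = y"
  by (auto simp: created_def side_next_child)

locale layout =
  fixes k :: nat and K :: "kind set"
  assumes hub_mem: "Hub \<in> K"
    and satellite_mem_iff: "Satellite y \<in> K \<longleftrightarrow> y \<in> set (satellites k)"
    and connector_mem: "Connector y t \<in> K \<Longrightarrow> t \<in> K"
    and cell_counter: "Cell c p \<in> K \<Longrightarrow> c < k"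
    and parent_mem: "Cell c q \<in> K \<Longrightarrow> is_child p q \<Longrightarrow> Cell c p \<in> K"
    and next_level_mem: "Cell c (l, Suc 0) \<in> K \<Longrightarrow> Cell c (Suc l, 0) \<in> K"
begin

lemma next_child_notin: "status K c p < 2 \<Longrightarrow> Cell c (next_child K c p) \<notin> K"
  by (cases p) (auto simp: status.simps next_child.simps split: if_splits)

lemma created_notin: "is_Cell (created K c p y) \<Longrightarrow> created K c p y \<notin> K"
  using next_child_notin by (auto simp: created_def split: if_splits)

lemma child_mem:
  assumes "status K c (l, d) = 2"
  shows "Cell c (l, Suc d) \<in> K"
  using assms by (simp add: status.simps split: if_splits)

lemma upper_mem:
  assumes "status K c (l, 0) \<noteq> 0"
  shows "Cell c (Suc l, 0) \<in> K"
  using assms by (simp add: status.simps split: if_splits)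

lemma status_child_mem: "Cell c (l, Suc d) \<in> K \<Longrightarrow> status K c (l, d) = 2"
  using next_level_mem by (cases d) (auto simp: status.simps)

lemma status_insert_next_child:
  assumes "status K c p < 2"
  shows "status (insert (Cell c (next_child K c p)) K) c' q =
    (if c' = c \<and> q = p then Suc (status K c p) else status K c' q)"
proof (cases "c' = c \<and> q = p")
  case True
  then show ?thesis
    using assms next_level_mem by (cases p) (auto simp: status.simps next_child.simps split: if_splits)
next
  case False
  then have "Cell c' r \<noteq> Cell c (next_child K c p)" if "is_child q r" for r
    using is_child_parent_unique[OF that, of p] is_child_next_child[of p K c] by auto
  then show ?thesis
    using False by (cases q) (auto simp: status.simps)
qed

lemma status_of_next_child:
  assumes "status K c p < 2"
  shows "status (insert (Cell c (next_child K c p)) K) c (next_child K c p) = (if status K c p = 0 then 0 else 1)"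
proof -
  have no_child: "Cell c r \<notin> insert (Cell c (next_child K c p)) K" if "is_child (next_child K c p) r" for r
  proof -
    have "Cell c r \<notin> K"
      using parent_mem[OF _ that] next_child_notin[OF assms] by blast
    moreover have "r \<noteq> next_child K c p"
      using that is_child_irrefl by metis
    ultimately show ?thesis by simp
  qed
  obtain l d where next_child: "next_child K c p = (l, d)" by fastforce
  have "status (insert (Cell c (l, d)) K) c (l, d) = (if d = 0 then 0 else 1)"
    using no_child[of "(Suc l, 0)"] no_child[of "(l, Suc d)"] by (simp add: next_child status.simps)
  moreover have "d = 0 \<longleftrightarrow> status K c p = 0"
    using next_child_props(2)[of K c p] by (auto simp: next_child)
  ultimately show ?thesis
    unfolding next_child by simp
qed

lemma linked_created_iff:
  assumes "a \<in> K"
  shows "linked a (created K c p y) \<longleftrightarrow> a \<in> {Hub, Cell c p, Satellite y}"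
proof (cases "is_Cell (created K c p y)")
  case True
  then have created: "created K c p y = Cell c (next_child K c p)" and opposite: "y = opposite_side c p"
    and status: "status K c p < 2"
    by (auto simp: created_def split: if_splits)
  have "\<not> is_child (next_child K c p) q" if "Cell c q \<in> K" for q
    using parent_mem[OF that] next_child_notin[OF status] by blast
  moreover have "Connector z (Cell c (next_child K c p)) \<notin> K" for z
    using connector_mem next_child_notin[OF status] by blast
  ultimately have "\<not> attached (Cell c (next_child K c p)) a"
    using assms by (cases a) auto
  then show ?thesis
    using opposite unfolding created linked_def
    by (cases a) (auto simp: is_child_next_child side_next_child
      dest: is_child_parent_unique[OF _ is_child_next_child])
next
  case False
  then show ?thesis
    by (cases a) (auto simp: created_def linked_def split: if_splits)
qed

lemma layout_insert_created:
  assumes "Cell c p \<in> K"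
  shows "layout k (insert (created K c p y) K)"
proof
  fix c' q r assume child: "Cell c' r \<in> insert (created K c p y) K" "is_child q r"
  show "Cell c' q \<in> insert (created K c p y) K"
  proof (cases "Cell c' r \<in> K")
    case False
    then have "c' = c" "r = next_child K c p"
      using child(1) by (auto simp: created_def split: if_splits)
    then show ?thesis
      using assms child(2) is_child_parent_unique[OF _ is_child_next_child] by blast
  qed (use parent_mem child(2) in blast)
next
  show "c' < k" if "Cell c' q \<in> insert (created K c p y) K" for c' q
    using that cell_counter[OF assms] cell_counter[of c' q] by (auto simp: created_def split: if_splits)
next
  fix c' l assume "Cell c' (l, Suc 0) \<in> insert (created K c p y) K"
  then show "Cell c' (Suc l, 0) \<in> insert (created K c p y) K"
    using next_level_mem by (cases p) (auto simp: created_def status.simps next_child.simps split: if_splits)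
qed (use assms hub_mem satellite_mem_iff connector_mem in \<open>auto simp: created_def split: if_splits\<close>)

end

subsection \<open>Labels and rules\<close>

text \<open>In control state \<open>At l\<close> every counter rests, and in \<open>Shift l c r\<close> counter \<open>c\<close> is on its way to a level with
  residue \<open>r\<close> modulo 4, after which the control passes to \<open>l\<close>. Residues modulo 4 tell an upward from a downward
  step and determine the parity.\<close>
datatype control = At nat | Shift nat nat nat

datatype label = Hub_Label control | Satellite_Label satellite | Connector_Label
  | is_Cell_Label: Cell_Label (counter: nat) (dummy: bool) (bottom: bool) (children: nat) (residue: nat)

instance satellite :: countable by countable_datatype
instance control :: countable by countable_datatype
instance label :: countable by countable_datatype

fun label_of :: "control \<Rightarrow> kind set \<Rightarrow> kind \<Rightarrow> label" where
  "label_of s K Hub = Hub_Label s"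
| "label_of s K (Satellite y) = Satellite_Label y"
| "label_of s K (Connector y t) = Connector_Label"
| "label_of s K (Cell c p) = Cell_Label c (0 < snd p) (p = (0, 0)) (status K c p) ((fst p + snd p) mod 4)"

fun due :: "control \<Rightarrow> label \<Rightarrow> bool" where
  "due (Shift l c r) x \<longleftrightarrow> counter x = c \<and> (dummy x \<or> residue x \<noteq> r)"
| "due (At l) x \<longleftrightarrow> False"

fun control_reply :: "cm_prog \<Rightarrow> control \<Rightarrow> label \<Rightarrow> control option" where
  "control_reply P (At l) x =
     (if l < length P \<and> counter x = instr_reg (P ! l) \<and> \<not> dummy x then
        (case P ! l of
           Inc c l' \<Rightarrow> Some (Shift l' c (Suc (residue x) mod 4))
         | Dec c l1 l2 \<Rightarrow> if bottom x then Some (At l2) else Some (Shift l1 c ((residue x + 3) mod 4)))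
      else None)"
| "control_reply P (Shift l c r) x =
     (if counter x \<noteq> c then None
      else if dummy x \<or> residue x mod 2 \<noteq> r mod 2 then Some (Shift l c r)
      else if residue x = r then Some (At l) else None)"

fun reply :: "cm_prog \<Rightarrow> control \<Rightarrow> label \<Rightarrow> satellite \<Rightarrow> control option" where
  "reply P s x Clock = control_reply P s x"
| "reply P s x (Parity c j) =
     (if counter x \<noteq> c \<or> j = Suc (residue x) mod 2 \<and> children x = 2 \<and> due s x then None else Some s)"

fun grows :: "label \<Rightarrow> satellite \<Rightarrow> bool" where
  "grows (Cell_Label c d z n r) y \<longleftrightarrow> n < 2 \<and> y = Parity c (Suc r mod 2)"
| "grows _ y \<longleftrightarrow> False"

fun grown_label :: "label \<Rightarrow> satellite \<Rightarrow> label" where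
  "grown_label (Cell_Label c d z n r) y =
     Cell_Label c d z (if grows (Cell_Label c d z n r) y then Suc n else n) r"
| "grown_label x y = x"

fun created_label :: "label \<Rightarrow> satellite \<Rightarrow> label" where
  "created_label (Cell_Label c d z n r) y = (if grows (Cell_Label c d z n r) y
     then Cell_Label c (n \<noteq> 0) False (of_bool (n \<noteq> 0)) (Suc r mod 4) else Connector_Label)"
| "created_label x y = Connector_Label"

definition create_rule :: "control \<Rightarrow> label \<Rightarrow> satellite \<Rightarrow> control \<Rightarrow> rule" where
  "create_rule s x y s' = Create False
     [(to_nat (Hub_Label s), to_nat (Hub_Label s')), (to_nat x, to_nat (grown_label x y)),
      (to_nat (Satellite_Label y), to_nat (Satellite_Label y))] (to_nat (created_label x y))"

definition controls :: "nat \<Rightarrow> nat \<Rightarrow> control list" where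
  "controls n k = map At [0..<n] @ [Shift l c r. l \<leftarrow> [0..<n], c \<leftarrow> [0..<k], r \<leftarrow> [0..<4]]"

definition cell_labels :: "nat \<Rightarrow> label list" where
  "cell_labels k = [Cell_Label c d z n r.
     c \<leftarrow> [0..<k], d \<leftarrow> [False, True], z \<leftarrow> [False, True], n \<leftarrow> [0..<3], r \<leftarrow> [0..<4]]"

definition game_rules :: "cm_prog \<Rightarrow> nat \<Rightarrow> rule list" where
  "game_rules P k =
     map (\<lambda>(s, x, y). create_rule s x y (the (reply P s x y)))
       (filter (\<lambda>(s, x, y). reply P s x y \<noteq> None)
         (List.product (controls (length P) k) (List.product (cell_labels k) (satellites k)))) @
     map (\<lambda>(x, y). Move (to_nat x) (to_nat y))
       (filter (\<lambda>(x, y). children x = 2) (List.product (cell_labels k) (cell_labels k)))"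

lemma in_controls: "s \<in> set (controls n k) \<longleftrightarrow>
    (\<exists>l<n. s = At l) \<or> (\<exists>l c r. l < n \<and> c < k \<and> r < 4 \<and> s = Shift l c r)"
  by (auto simp: controls_def image_iff simp del: upt_rec_numeral)

lemma in_cell_labels: "x \<in> set (cell_labels k) \<longleftrightarrow> is_Cell_Label x \<and> counter x < k \<and> children x \<le> 2 \<and> residue x < 4"
proof -
  have "x \<in> set (cell_labels k) \<longleftrightarrow> (\<exists>c d z n r. x = Cell_Label c d z n r \<and> c < k \<and> n < 3 \<and> r < 4)"
    by (auto simp: cell_labels_def image_iff simp del: upt_rec_numeral)
  then show ?thesis
    by (cases x) auto
qed

lemma in_game_rules: "r \<in> set (game_rules P k) \<longleftrightarrow>
    (\<exists>s x y s'. s \<in> set (controls (length P) k) \<and> x \<in> set (cell_labels k) \<and> y \<in> set (satellites k) \<and>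
       reply P s x y = Some s' \<and> r = create_rule s x y s') \<or>
    (\<exists>x y. x \<in> set (cell_labels k) \<and> y \<in> set (cell_labels k) \<and> children x = 2 \<and> r = Move (to_nat x) (to_nat y))"
proof -
  have create: "(\<exists>s'. opt = Some s' \<and> r = create_rule s x y s') \<longleftrightarrow> opt \<noteq> None \<and> r = create_rule s x y (the opt)"
    for s x y opt
    by auto
  show ?thesis
    unfolding game_rules_def by (simp add: image_iff create flip: ex_simps(1))
qed

lemma game_rules_weak: "r \<in> set (game_rules P k) \<Longrightarrow> \<not> is_strong_creation r"
  by (auto simp: in_game_rules create_rule_def)

lemma label_of_Cell_mem_cell_labels: "c < k \<Longrightarrow> label_of s K (Cell c p) \<in> set (cell_labels k)"
  using status_le[of K c p] by (simp add: in_cell_labels)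

lemma mod4_mod2: "n mod 4 mod 2 = n mod (2::nat)"
  by (rule mod_mod_cancel) simp

lemma Suc_mod4_mod2: "Suc (n mod 4) mod 2 = Suc n mod 2"
  using mod_Suc_eq[of "n mod 4" 2] mod_Suc_eq[of n 2] by (simp add: mod4_mod2)

lemma grows_label_of_iff: "grows (label_of s K (Cell c p)) y \<longleftrightarrow> y = opposite_side c p \<and> status K c p < 2"
  by (auto simp: Suc_mod4_mod2 opposite_side_def)

context layout
begin

lemma label_of_created:
  "label_of s' (insert (created K c p y) K) (created K c p y) = created_label (label_of s K (Cell c p)) y"
proof (cases "y = opposite_side c p \<and> status K c p < 2")
  case True
  then have "grows (label_of s K (Cell c p)) y"
    using grows_label_of_iff by blast
  then show ?thesis
    using True status_of_next_child[of c p]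
    by (simp add: created_def next_child_props mod_Suc_eq opposite_side_def Suc_mod4_mod2)
next
  case False
  then have "\<not> grows (label_of s K (Cell c p)) y"
    using grows_label_of_iff by blast
  then show ?thesis
    using False by (auto simp: created_def)
qed

lemma label_of_insert_created:
  "label_of s' (insert (created K c p y) K) a =
    (if a = Hub then Hub_Label s' else if a = Cell c p then grown_label (label_of s K a) y else label_of s K a)"
proof -
  have "status (insert (created K c p y) K) c' q =
      (if c' = c \<and> q = p \<and> grows (label_of s K (Cell c p)) y then Suc (status K c p) else status K c' q)" for c' q
  proof (cases "y = opposite_side c p \<and> status K c p < 2")
    case True
    then show ?thesis
      using status_insert_next_child[of c p] by (simp only: grows_label_of_iff created_def) simp
  next
    case False
    then show ?thesis
      by (auto simp: grows_label_of_iff created_def status_insert_Connector simp del: label_of.simps)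
  qed
  then show ?thesis
    by (cases a) auto
qed

end

subsection \<open>Arenas\<close>

fun kind_strong :: "(nat \<Rightarrow> position) \<Rightarrow> kind \<Rightarrow> bool" where
  "kind_strong pos (Connector y t) \<longleftrightarrow> False"
| "kind_strong pos (Cell c p) \<longleftrightarrow> pos c = p"
| "kind_strong pos _ \<longleftrightarrow> True"

text \<open>The strong cell of counter \<open>c\<close>, its token, is at position \<open>pos c\<close>.\<close>
locale arena = layout k "kind ` nodes G" for k and G :: network and kind :: "nat \<Rightarrow> kind" +
  fixes ctl :: control and pos :: "nat \<Rightarrow> position"
  assumes finite_nodes: "finite (nodes G)"
    and edges_eq: "edges G = {(u, v). u \<in> nodes G \<and> v \<in> nodes G \<and> linked (kind u) (kind v)}"
    and kind_inj: "u \<in> nodes G \<Longrightarrow> v \<in> nodes G \<Longrightarrow> kind u = kind v \<Longrightarrow> \<not> is_Connector (kind u) \<Longrightarrow> u = v"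
    and lab_eq: "v \<in> nodes G \<Longrightarrow> lab G v = to_nat (label_of ctl (kind ` nodes G) (kind v))"
    and active_nodes: "active G \<subseteq> nodes G"
    and strong_eq: "strong G = {v \<in> nodes G. kind_strong pos (kind v)}"
    and strong_active: "strong G \<subseteq> active G"
    and token_mem: "c < k \<Longrightarrow> Cell c (pos c) \<in> kind ` nodes G"
begin

abbreviation kinds :: "kind set" where
  "kinds \<equiv> kind ` nodes G"

abbreviation token_label :: "nat \<Rightarrow> label" where
  "token_label c \<equiv> label_of ctl kinds (Cell c (pos c))"

lemma hub_node: obtains h where "h \<in> nodes G" "kind h = Hub"
  using hub_mem by auto

lemma satellite_node:
  assumes "y \<in> set (satellites k)"
  obtains s where "s \<in> nodes G" "kind s = Satellite y"
  using assms satellite_mem_iff[of y] by auto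

lemma token_node:
  assumes "c < k"
  obtains t where "t \<in> nodes G" "kind t = Cell c (pos c)"
  using token_mem[OF assms] by auto

lemma new_node: obtains w where "w \<notin> nodes G"
  using finite_nodes ex_new_if_finite infinite_UNIV_nat by blast

end

definition live :: "network \<Rightarrow> (nat \<Rightarrow> kind) \<Rightarrow> satellite \<Rightarrow> nat set" where
  "live G kind y = {v \<in> active G. serves (kind v) y}"

definition delete :: "network \<Rightarrow> nat \<Rightarrow> network" where
  "delete G v = G\<lparr>active := active G - {v}\<rparr>"

definition shift :: "network \<Rightarrow> nat \<Rightarrow> nat \<Rightarrow> network" where
  "shift G u v = G\<lparr>strong := (strong G - {u}) \<union> {v}, active := active G \<union> {v}\<rparr>"

definition attach :: "network \<Rightarrow> nat \<Rightarrow> nat \<Rightarrow> nat \<times> nat \<Rightarrow> nat \<times> nat \<Rightarrow> nat \<times> nat \<Rightarrow> network" where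
  "attach G w m = (\<lambda>(h, a) (t, b) (s, d). \<lparr>nodes = insert w (nodes G),
     edges = edges G \<union> {(w, u) |u. u \<in> {h, t, s}} \<union> {(u, w) |u. u \<in> {h, t, s}},
     active = insert w (active G), strong = strong G,
     lab = (lab G)(s := d, t := b, h := a, w := m)\<rparr>)"

abbreviation attach_created :: "network \<Rightarrow> nat \<Rightarrow> nat \<Rightarrow> nat \<Rightarrow> nat \<Rightarrow> label \<Rightarrow> satellite \<Rightarrow> control \<Rightarrow> network" where
  "attach_created G w h t s x y s' \<equiv> attach G w (to_nat (created_label x y))
     (h, to_nat (Hub_Label s')) (t, to_nat (grown_label x y)) (s, to_nat (Satellite_Label y))"

lemma delete_simps [simp]:
  "nodes (delete G v) = nodes G" "edges (delete G v) = edges G" "active (delete G v) = active G - {v}"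
  "strong (delete G v) = strong G" "lab (delete G v) = lab G"
  by (simp_all add: delete_def)

lemma shift_simps [simp]:
  "nodes (shift G u v) = nodes G" "edges (shift G u v) = edges G" "active (shift G u v) = insert v (active G)"
  "strong (shift G u v) = insert v (strong G - {u})" "lab (shift G u v) = lab G"
  by (simp_all add: shift_def)

lemma attach_simps [simp]:
  "nodes (attach G w m (h, a) (t, b) (s, d)) = insert w (nodes G)"
  "edges (attach G w m (h, a) (t, b) (s, d)) =
     edges G \<union> {(w, u) |u. u \<in> {h, t, s}} \<union> {(u, w) |u. u \<in> {h, t, s}}"
  "active (attach G w m (h, a) (t, b) (s, d)) = insert w (active G)"
  "strong (attach G w m (h, a) (t, b) (s, d)) = strong G"
  "lab (attach G w m (h, a) (t, b) (s, d)) = (lab G)(s := d, t := b, h := a, w := m)"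
  by (simp_all add: attach_def)

lemma destructor_moves_eq: "destructor_moves G = insert G {delete G v |v. v \<in> active G - strong G}"
  by (simp add: destructor_moves_def delete_def)

lemma constructor_movesI: "r \<in> set R \<Longrightarrow> apply_rule r G G' \<Longrightarrow> G' \<in> constructor_moves R G"
  by (auto simp: constructor_moves_def)

lemma live_delete: "live (delete G v) kind y = live G kind y - {v}"
  by (auto simp: live_def)

lemma move_step_iff:
  "move_step G a b G' \<longleftrightarrow> (\<exists>u v. u \<in> strong G \<and> lab G u = a \<and> v \<in> nodes G \<and> v \<notin> strong G \<and> lab G v = b \<and>
     (u, v) \<in> edges G \<and> G' = shift G u v)"
  by (simp add: move_step_def shift_def)

lemma create_step_three_iff:
  "create_step G False [(a, a'), (b, b'), (d, d')] m G' \<longleftrightarrow>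
     (\<exists>h t s w. distinct [h, t, s] \<and> {h, t, s} \<subseteq> strong G \<and> lab G h = a \<and> lab G t = b \<and> lab G s = d \<and>
        w \<notin> nodes G \<and> G' = attach G w m (h, a') (t, b') (s, d'))"
    (is "?L \<longleftrightarrow> ?R")
proof -
  have three: "(\<forall>i<length [(a, a'), (b, b'), (d, d')]. Q i) \<longleftrightarrow> Q 0 \<and> Q 1 \<and> Q 2" for Q
    by (auto simp: less_Suc_eq numeral_2_eq_2)
  have lists: "(\<exists>us. length us = length [(a, a'), (b, b'), (d, d')] \<and> Q us) \<longleftrightarrow> (\<exists>h t s. Q [h, t, s])"
    for Q :: "nat list \<Rightarrow> bool"
    by (simp add: length_Suc_conv) blast
  show ?thesis
    unfolding create_step_def three ex_simps(1)[symmetric] conj_assoc lists ex_simps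
    by (auto simp: attach_def)
qed

context arena
begin

lemma kind_strong_created: "\<not> kind_strong pos (created K c (pos c) y)"
  using is_child_next_child[of "pos c" K c] is_child_irrefl[of "pos c"] by (auto simp: created_def)

lemma kind_neq_created:
  assumes "u \<in> nodes G" "\<not> is_Connector (kind u)"
  shows "kind u \<noteq> created kinds c (pos c) y"
proof
  assume eq: "kind u = created kinds c (pos c) y"
  then have "is_Cell (created kinds c (pos c) y)"
    using assms(2) by (auto simp: created_def split: if_splits)
  then show False
    using created_notin[of c "pos c" y] assms(1) by (metis eq imageI)
qed

lemma kinds_insert:
  assumes "w \<notin> nodes G"
  shows "(kind(w := a)) ` insert w (nodes G) = insert a kinds"
  by (simp only: fun_upd_image) (use assms in simp)

context
  fixes h t s w c :: nat and y :: satellite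
  assumes hub: "h \<in> nodes G" "kind h = Hub"
    and token: "t \<in> nodes G" "kind t = Cell c (pos c)"
    and satellite: "s \<in> nodes G" "kind s = Satellite y"
    and fresh: "w \<notin> nodes G"
begin

abbreviation new_kind :: "nat \<Rightarrow> kind" where
  "new_kind \<equiv> kind(w := created kinds c (pos c) y)"

lemma new_kind_old: "u \<in> nodes G \<Longrightarrow> new_kind u = kind u"
  using fresh by auto

lemma linked_created_node:
  assumes "u \<in> nodes G"
  shows "linked (kind u) (created kinds c (pos c) y) \<longleftrightarrow> u \<in> {h, t, s}"
proof -
  have "kind u \<in> {Hub, Cell c (pos c), Satellite y} \<longleftrightarrow> u \<in> {h, t, s}"
    using kind_inj[OF assms] hub token satellite by auto
  then show ?thesis
    using linked_created_iff[of "kind u"] assms by simp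
qed

lemma edges_attach:
  "edges (attach G w m (h, a) (t, b) (s, d)) = {(u, v). u \<in> insert w (nodes G) \<and> v \<in> insert w (nodes G) \<and>
     linked (new_kind u) (new_kind v)}"
proof -
  have linked_old: "linked (new_kind u) (new_kind v) \<longleftrightarrow> linked (kind u) (kind v)" if "u \<in> nodes G" "v \<in> nodes G" for u v
    using that new_kind_old by simp
  have linked_new: "linked (new_kind u) (new_kind w) \<longleftrightarrow> u \<in> {h, t, s}" "linked (new_kind w) (new_kind u) \<longleftrightarrow> u \<in> {h, t, s}"
    if "u \<in> nodes G" for u
    using linked_created_node[OF that] linked_sym new_kind_old[OF that] by auto
  show ?thesis
    using linked_old linked_new linked_irrefl[of "new_kind w"] hub(1) token(1) satellite(1)
    by (auto simp: edges_eq simp del: fun_upd_apply)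
qed

lemma lab_attach_created:
  assumes "u \<in> insert w (nodes G)"
  shows "lab (attach_created G w h t s (token_label c) y s') u =
    to_nat (label_of s' (insert (created kinds c (pos c) y) kinds) (new_kind u))"
proof (cases "u = w")
  case True
  then show ?thesis
    using label_of_created[of s' c "pos c" y ctl] by simp
next
  case False
  then have mem: "u \<in> nodes G"
    using assms by simp
  have "kind u = Hub \<longleftrightarrow> u = h" "kind u = Cell c (pos c) \<longleftrightarrow> u = t" "kind u = Satellite y \<longleftrightarrow> u = s"
    using kind_inj[OF mem] hub token satellite by auto
  then show ?thesis
    using False mem label_of_insert_created[of s' c "pos c" y "kind u" ctl] hub token satellite lab_eq[OF mem] by auto
qed

lemma arena_attach_created:
  assumes "c < k"
  shows "arena k (attach_created G w h t s (token_label c) y s') new_kind s' pos"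
    (is "arena k ?G _ _ _")
proof -
  have kinds': "new_kind ` nodes ?G = insert (created kinds c (pos c) y) kinds"
    using kinds_insert[OF fresh] by simp
  interpret new: layout k "new_kind ` nodes ?G"
    unfolding kinds' by (rule layout_insert_created[OF token_mem[OF assms]])
  show ?thesis
  proof
    show "edges ?G = {(u, v). u \<in> nodes ?G \<and> v \<in> nodes ?G \<and> linked (new_kind u) (new_kind v)}"
      unfolding attach_simps(1) by (rule edges_attach)
    show "u = v" if "u \<in> nodes ?G" "v \<in> nodes ?G" "new_kind u = new_kind v" "\<not> is_Connector (new_kind u)" for u v
      using that kind_inj[of u v] kind_neq_created[of u c y] kind_neq_created[of v c y]
      by (cases "u = w"; cases "v = w") auto
    show "lab ?G u = to_nat (label_of s' (new_kind ` nodes ?G) (new_kind u))" if "u \<in> nodes ?G" for u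
      using that unfolding attach_simps(1) kinds_insert[OF fresh] by (rule lab_attach_created)
    show "strong ?G = {u \<in> nodes ?G. kind_strong pos (new_kind u)}"
      using fresh new_kind_old kind_strong_created by (auto simp: strong_eq)
  qed (use strong_active active_nodes token_mem kinds' finite_nodes in auto)
qed

end

lemma arena_delete:
  assumes "v \<notin> strong G"
  shows "arena k (delete G v) kind ctl pos"
proof -
  interpret deleted: layout k "kind ` nodes (delete G v)"
    using layout_axioms by simp
  show ?thesis
    using assms finite_nodes edges_eq kind_inj lab_eq active_nodes strong_eq strong_active token_mem
    by unfold_locales auto
qed

lemma arena_shift:
  assumes "c < k" "t \<in> nodes G" "kind t = Cell c (pos c)" "v \<in> nodes G" "kind v = Cell c q"
  shows "arena k (shift G t v) kind ctl (pos(c := q))"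
proof -
  interpret shifted: layout k "kind ` nodes (shift G t v)"
    using layout_axioms by simp
  show ?thesis
  proof
    have "kind_strong (pos(c := q)) a \<longleftrightarrow> a = Cell c q \<or> kind_strong pos a \<and> a \<noteq> Cell c (pos c)" for a
      by (cases a) auto
    moreover have "kind u = Cell c q \<longleftrightarrow> u = v" "kind u = Cell c (pos c) \<longleftrightarrow> u = t" if "u \<in> nodes G" for u
      using kind_inj[OF that] assms by auto
    ultimately show "strong (shift G t v) = {u \<in> nodes (shift G t v). kind_strong (pos(c := q)) (kind u)}"
      using assms(4) by (auto simp: strong_eq)
    show "Cell d ((pos(c := q)) d) \<in> kind ` nodes (shift G t v)" if "d < k" for d
      using token_mem[OF that] assms(4,5) by (auto intro: image_eqI[of _ _ v])
  qed (use assms finite_nodes edges_eq kind_inj lab_eq active_nodes strong_active in auto)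
qed

lemma active_if_kind_strong: "v \<in> nodes G \<Longrightarrow> kind_strong pos (kind v) \<Longrightarrow> v \<in> active G"
  using strong_active by (auto simp: strong_eq)

lemma live_nonempty_if_connected:
  assumes "net_connected G" "y \<in> set (satellites k)"
  shows "live G kind y \<noteq> {}"
proof -
  obtain h s where nodes: "h \<in> nodes G" "kind h = Hub" "s \<in> nodes G" "kind s = Satellite y"
    using hub_node satellite_node[OF assms(2)] by metis
  then have "(s, h) \<in> (edges G \<inter> active G \<times> active G)\<^sup>*" "s \<noteq> h"
    using assms(1) active_if_kind_strong unfolding net_connected_def by auto
  then obtain v where "(s, v) \<in> edges G" "v \<in> active G"
    by (meson Int_iff SigmaE2 converse_rtranclE)
  then have "v \<in> active G" "linked (Satellite y) (kind v)"
    using nodes by (auto simp: edges_eq)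
  then have "v \<in> live G kind y"
    by (cases "kind v") (auto simp: live_def linked_def)
  then show ?thesis by auto
qed

lemma connected_if_live_nonempty:
  assumes live: "\<And>y. y \<in> set (satellites k) \<Longrightarrow> live G kind y \<noteq> {}"
  shows "net_connected G"
proof -
  let ?E = "edges G \<inter> active G \<times> active G"
  obtain h where hub: "h \<in> nodes G" "kind h = Hub"
    by (rule hub_node)
  have hub_edge: "(h, v) \<in> ?E" if "v \<in> active G" "is_Connector (kind v) \<or> is_Cell (kind v)" for v
    using that hub active_if_kind_strong active_nodes by (auto simp: edges_eq linked_def)
  have hub_path: "(h, v) \<in> ?E\<^sup>*" if active: "v \<in> active G" for v
  proof (cases "kind v")
    case Hub
    then have "v = h"
      using kind_inj hub active active_nodes by auto
    then show ?thesis by simp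
  next
    case (Satellite y)
    then have "y \<in> set (satellites k)"
      using active active_nodes satellite_mem_iff by force
    then obtain u where "u \<in> active G" "serves (kind u) y"
      using live by (auto simp: live_def)
    then have "(h, u) \<in> ?E" "(u, v) \<in> ?E"
      using hub_edge[of u] active active_nodes Satellite by (cases "kind u"; auto simp: edges_eq linked_def)+
    then show ?thesis by (meson converse_rtrancl_into_rtrancl r_into_rtrancl)
  qed (use hub_edge[OF active] in auto)
  have "sym ?E"
    using linked_sym by (auto simp: sym_def edges_eq)
  then show ?thesis
    unfolding net_connected_def using hub_path sym_rtrancl by (meson rtrancl_trans symD)
qed

lemma net_connected_iff: "net_connected G \<longleftrightarrow> (\<forall>y\<in>set (satellites k). live G kind y \<noteq> {})"
  using live_nonempty_if_connected connected_if_live_nonempty by blast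

subsection \<open>Constructor's moves\<close>

lemma strong_Hub_LabelD:
  assumes "v \<in> strong G" "lab G v = to_nat (Hub_Label s)"
  shows "kind v = Hub \<and> s = ctl"
  using assms lab_eq[of v] by (cases "kind v") (auto simp: strong_eq)

lemma strong_Satellite_LabelD:
  assumes "v \<in> strong G" "lab G v = to_nat (Satellite_Label y)"
  shows "kind v = Satellite y"
  using assms lab_eq[of v] by (cases "kind v") (auto simp: strong_eq)

lemma is_Cell_LabelD:
  assumes "v \<in> nodes G" "lab G v = to_nat x" "is_Cell_Label x"
  obtains c p where "c < k" "kind v = Cell c p" "x = label_of ctl kinds (Cell c p)"
proof -
  have label: "x = label_of ctl kinds (kind v)"
    using lab_eq[OF assms(1)] assms(2) by simp
  obtain c p where "kind v = Cell c p"
    using assms(3) label by (cases "kind v") auto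
  then show thesis
    using that label cell_counter assms(1) by (metis imageI)
qed

lemma create_rule_soundE:
  assumes "apply_rule (create_rule s x y s') G G'" "x \<in> set (cell_labels k)"
  obtains c w where "c < k" "s = ctl" "x = token_label c" "w \<notin> nodes G"
    "arena k G' (kind(w := created kinds c (pos c) y)) s' pos"
    "nodes G' = insert w (nodes G)" "active G' = insert w (active G)"
proof -
  obtain h t u w where strong: "{h, t, u} \<subseteq> strong G"
    and labels: "lab G h = to_nat (Hub_Label s)" "lab G t = to_nat x" "lab G u = to_nat (Satellite_Label y)"
    and fresh: "w \<notin> nodes G"
    and attach: "G' = attach_created G w h t u x y s'"
    using assms(1) unfolding create_rule_def apply_rule.simps create_step_three_iff by blast
  have nodes: "h \<in> nodes G" "t \<in> nodes G" "u \<in> nodes G"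
    using strong by (auto simp: strong_eq)
  obtain c p where cell: "c < k" "kind t = Cell c p" "x = label_of ctl kinds (Cell c p)"
    using is_Cell_LabelD[OF nodes(2) labels(2)] assms(2) unfolding in_cell_labels by metis
  have token: "p = pos c"
    using strong cell(2) by (simp add: strong_eq)
  have hub: "kind h = Hub" "s = ctl" and satellite: "kind u = Satellite y"
    using strong_Hub_LabelD[OF _ labels(1)] strong_Satellite_LabelD[OF _ labels(3)] strong by auto
  have "arena k G' (kind(w := created kinds c (pos c) y)) s' pos"
    unfolding attach cell(3) token
    by (rule arena_attach_created[OF nodes(1) hub(1) nodes(2) _ nodes(3) satellite fresh cell(1)]) (simp add: cell token)
  moreover have "nodes G' = insert w (nodes G)" "active G' = insert w (active G)"
    by (simp_all add: attach)
  ultimately show thesis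
    using that cell hub fresh token by blast
qed

lemma create_rule_complete:
  assumes "c < k" "y \<in> set (satellites k)" "w \<notin> nodes G"
  shows "\<exists>G'. apply_rule (create_rule ctl (token_label c) y s') G G' \<and>
    arena k G' (kind(w := created kinds c (pos c) y)) s' pos \<and> active G' = insert w (active G)"
proof -
  obtain h t u where nodes: "h \<in> nodes G" "kind h = Hub" "t \<in> nodes G" "kind t = Cell c (pos c)"
      "u \<in> nodes G" "kind u = Satellite y"
    using hub_node token_node[OF assms(1)] satellite_node[OF assms(2)] by metis
  let ?G' = "attach_created G w h t u (token_label c) y s'"
  have "distinct [h, t, u]" "{h, t, u} \<subseteq> strong G"
    using nodes by (auto simp: strong_eq)
  moreover have "lab G h = to_nat (Hub_Label ctl)" "lab G t = to_nat (token_label c)"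
      "lab G u = to_nat (Satellite_Label y)"
    using nodes lab_eq by simp_all
  ultimately have "apply_rule (create_rule ctl (token_label c) y s') G ?G'"
    unfolding create_rule_def apply_rule.simps create_step_three_iff using assms(3) by blast
  then show ?thesis
    using arena_attach_created[OF nodes assms(3,1)] by (intro exI[of _ ?G']) simp
qed

lemma move_rule_soundE:
  assumes "apply_rule (Move (to_nat x) (to_nat y)) G G'" "x \<in> set (cell_labels k)" "y \<in> set (cell_labels k)"
  obtains c v q where "c < k" "x = token_label c" "v \<in> nodes G" "kind v = Cell c q" "adjacent (pos c) q"
    "arena k G' kind ctl (pos(c := q))" "nodes G' = nodes G" "active G' = insert v (active G)"
proof -
  obtain u v where strong: "u \<in> strong G" and labels: "lab G u = to_nat x" "lab G v = to_nat y"
    and target: "v \<in> nodes G" and edge: "(u, v) \<in> edges G" and shift: "G' = shift G u v"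
    using assms(1) unfolding apply_rule.simps move_step_iff by blast
  have source: "u \<in> nodes G"
    using strong by (simp add: strong_eq)
  obtain c p where cell: "c < k" "kind u = Cell c p" "x = label_of ctl kinds (Cell c p)"
    using is_Cell_LabelD[OF source labels(1)] assms(2) unfolding in_cell_labels by metis
  obtain c' q where target_cell: "kind v = Cell c' q"
    using is_Cell_LabelD[OF target labels(2)] assms(3) unfolding in_cell_labels by metis
  have token: "p = pos c"
    using strong cell(2) by (simp add: strong_eq)
  have "c' = c" "adjacent p q"
    using edge cell(2) target_cell by (auto simp: edges_eq linked_def adjacent_def)
  then show thesis
    using that[of c v q] arena_shift[OF cell(1) source _ target, of q] cell target target_cell
    by (simp add: shift token)
qed

lemma constructor_moveE:
  assumes "G' \<in> constructor_moves (game_rules P k) G"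
  obtains (skip) "G' = G"
  | (create) c y s' w where "c < k" "y \<in> set (satellites k)" "reply P ctl (token_label c) y = Some s'"
      "w \<notin> nodes G" "arena k G' (kind(w := created kinds c (pos c) y)) s' pos"
      "nodes G' = insert w (nodes G)" "active G' = insert w (active G)"
  | (move) c v q where "c < k" "status kinds c (pos c) = 2" "v \<in> nodes G" "kind v = Cell c q" "adjacent (pos c) q"
      "arena k G' kind ctl (pos(c := q))" "nodes G' = nodes G" "active G' = insert v (active G)"
proof -
  consider "G' = G" | r where "r \<in> set (game_rules P k)" "apply_rule r G G'"
    using assms by (auto simp: constructor_moves_def)
  then consider "G' = G"
    | (create_rule) s x y s' where "x \<in> set (cell_labels k)" "y \<in> set (satellites k)" "reply P s x y = Some s'"
        "apply_rule (create_rule s x y s') G G'"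
    | (move_rule) x y where "x \<in> set (cell_labels k)" "y \<in> set (cell_labels k)" "children x = 2"
        "apply_rule (Move (to_nat x) (to_nat y)) G G'"
    unfolding in_game_rules by metis
  then show thesis
  proof cases
    case create_rule
    then show thesis
      using create_rule_soundE[OF create_rule(4,1)] that(2) by metis
  next
    case move_rule
    show thesis
      by (rule move_rule_soundE[OF move_rule(4,1,2)]) (use that(3) move_rule(3) in simp)
  qed (use that(1) in blast)
qed

lemma ex_create_move:
  assumes "c < k" "y \<in> set (satellites k)" "ctl \<in> set (controls (length P) k)"
    and "reply P ctl (token_label c) y = Some s'" "w \<notin> nodes G"
  shows "\<exists>G'\<in>constructor_moves (game_rules P k) G.
    arena k G' (kind(w := created kinds c (pos c) y)) s' pos \<and> active G' = insert w (active G)"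
proof -
  have "create_rule ctl (token_label c) y s' \<in> set (game_rules P k)"
    unfolding in_game_rules using assms label_of_Cell_mem_cell_labels by blast
  then show ?thesis
    using create_rule_complete[OF assms(1,2,5), of s'] by (meson constructor_movesI)
qed

lemma ex_shift_move:
  assumes "c < k" "status kinds c (pos c) = 2" "v \<in> nodes G" "kind v = Cell c q" "adjacent (pos c) q"
  shows "\<exists>G'\<in>constructor_moves (game_rules P k) G.
    arena k G' kind ctl (pos(c := q)) \<and> active G' = insert v (active G)"
proof -
  obtain t where token: "t \<in> nodes G" "kind t = Cell c (pos c)"
    by (rule token_node[OF assms(1)])
  have "children (token_label c) = 2"
    using assms(2) by simp
  then have "Move (to_nat (token_label c)) (to_nat (label_of ctl kinds (Cell c q))) \<in> set (game_rules P k)"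
    unfolding in_game_rules using label_of_Cell_mem_cell_labels[OF assms(1)] by blast
  moreover have "apply_rule (Move (to_nat (token_label c)) (to_nat (label_of ctl kinds (Cell c q)))) G (shift G t v)"
  proof -
    have moved: "q \<noteq> pos c"
      using assms(5) by (auto simp: adjacent_def is_child_irrefl)
    show ?thesis
      unfolding apply_rule.simps move_step_iff
      by (rule exI[of _ t], rule exI[of _ v])
        (use moved token assms lab_eq[OF token(1)] lab_eq[OF assms(3)]
         in \<open>auto simp: strong_eq edges_eq linked_def adjacent_def\<close>)
  qed
  ultimately have "shift G t v \<in> constructor_moves (game_rules P k) G"
    by (rule constructor_movesI)
  then show ?thesis
    using arena_shift[OF assms(1) token assms(3,4)] by (intro bexI[of _ "shift G t v"]) simp_all
qed

end

section \<open>Constructor wins if the machine runs forever\<close>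

definition represents :: "nat \<Rightarrow> (nat \<Rightarrow> position) \<Rightarrow> (nat \<Rightarrow> nat) \<Rightarrow> bool" where
  "represents k pos reg \<longleftrightarrow> (\<forall>c<k. pos c = (reg c, 0))"

definition approaches :: "nat \<Rightarrow> nat \<Rightarrow> (nat \<Rightarrow> position) \<Rightarrow> (nat \<Rightarrow> nat) \<Rightarrow> bool" where
  "approaches k c pos reg \<longleftrightarrow> (\<forall>c'<k. c' \<noteq> c \<longrightarrow> pos c' = (reg c', 0)) \<and>
     (Suc (fst (pos c)) = reg c \<or> fst (pos c) = Suc (reg c))"

fun next_control :: "cm_prog \<Rightarrow> cm_config \<Rightarrow> control" where
  "next_control P (pc, reg) = (let (pc', reg') = cm_step P (pc, reg); c = instr_reg (P ! pc) in
     if reg' c = reg c then At pc' else Shift pc' c (reg' c mod 4))"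

fun simulates :: "nat \<Rightarrow> control \<Rightarrow> (nat \<Rightarrow> position) \<Rightarrow> cm_config \<Rightarrow> bool" where
  "simulates k s pos (pc, reg) \<longleftrightarrow> s = At pc \<and> represents k pos reg \<or>
     (\<exists>c<k. s = Shift pc c (reg c mod 4) \<and> (represents k pos reg \<or> approaches k c pos reg))"

lemma mod4_pred: "(Suc n mod 4 + 3) mod 4 = n mod (4::nat)"
  using mod_add_left_eq[of "Suc n" 4 3] by simp

lemma Suc_mod4_parity: "Suc n mod 4 mod 2 \<noteq> n mod 4 mod (2::nat)"
  unfolding mod4_mod2 by presburger

lemma control_reply_At:
  "control_reply P (At pc) (label_of s K (Cell c (reg c, 0))) =
     (if pc < length P \<and> c = instr_reg (P ! pc) then Some (next_control P (pc, reg)) else None)"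
proof (cases "P ! pc")
  case (Inc c' l)
  then show ?thesis
    by (auto simp: mod_Suc_eq)
next
  case (Dec c' l l')
  then show ?thesis
    by (cases "reg c'") (auto simp: mod4_pred)
qed

lemma control_reply_Shift_represents:
  "control_reply P (Shift l c (reg c mod 4)) (label_of s K (Cell c (reg c, 0))) = Some (At l)"
  by simp

lemma approaches_due:
  assumes "approaches k c pos reg"
  shows "due (Shift l c (reg c mod 4)) (label_of s K (Cell c (pos c)))"
    and "control_reply P (Shift l c (reg c mod 4)) (label_of s K (Cell c (pos c))) =
      Some (Shift l c (reg c mod 4))"
proof -
  have "fst (pos c) mod 4 mod 2 \<noteq> reg c mod 4 mod 2"
    using assms Suc_mod4_parity[of "fst (pos c)"] Suc_mod4_parity[of "reg c"] by (auto simp: approaches_def)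
  then show "due (Shift l c (reg c mod 4)) (label_of s K (Cell c (pos c)))"
    "control_reply P (Shift l c (reg c mod 4)) (label_of s K (Cell c (pos c))) = Some (Shift l c (reg c mod 4))"
    by auto
qed

lemma simulates_next_control:
  assumes "represents k pos reg" "pc < length P" "instr_reg (P ! pc) < k"
  shows "simulates k (next_control P (pc, reg)) pos (cm_step P (pc, reg))"
  using assms by (cases "P ! pc") (auto simp: represents_def approaches_def split: if_splits)

lemma simulates_controls:
  assumes "simulates k s pos conf" "fst conf < n"
  shows "s \<in> set (controls n k)"
  using assms by (cases conf) (auto simp: in_controls)

lemma control_progress:
  assumes simulates: "simulates k s pos conf" and regs: "\<And>i. i \<in> set P \<Longrightarrow> instr_reg i < k"
    and running: "\<not> cm_halted P conf"
  obtains c s' conf' where "c < k" "control_reply P s (label_of s K (Cell c (pos c))) = Some s'"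
    "simulates k s' pos conf'" "conf' = conf \<or> conf' = cm_step P conf"
proof -
  obtain pc reg where conf: "conf = (pc, reg)" by fastforce
  have instr: "pc < length P" "instr_reg (P ! pc) < k"
    using running regs by (simp_all add: conf cm_halted_def)
  from simulates consider (rest) "s = At pc" "represents k pos reg"
    | (arrived) c where "c < k" "s = Shift pc c (reg c mod 4)" "represents k pos reg"
    | (under_way) c where "c < k" "s = Shift pc c (reg c mod 4)" "approaches k c pos reg"
    unfolding conf simulates.simps by blast
  then show thesis
  proof cases
    case rest
    then have "control_reply P s (label_of s K (Cell (instr_reg (P ! pc)) (pos (instr_reg (P ! pc))))) =
        Some (next_control P (pc, reg))"
      using control_reply_At[of P pc] instr by (simp add: represents_def del: control_reply.simps label_of.simps)
    then show thesis
      using that instr(2) simulates_next_control[OF rest(2) instr] conf by blast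
  next
    case arrived
    then have "control_reply P s (label_of s K (Cell c (pos c))) = Some (At pc)"
      using control_reply_Shift_represents by (simp add: represents_def)
    then show thesis
      using that[of c "At pc" conf] arrived by (simp add: conf)
  next
    case under_way
    then show thesis
      using that[of c s conf] approaches_due(2) simulates by metis
  qed
qed

text \<open>A counter that has to move has two neighbouring cells to go to. Both serve the same satellite, so one of them
  is inactive when that satellite is about to be cut off.\<close>
lemma (in layout) two_targets:
  assumes "approaches k c pos reg" "c < k" "Cell c (pos c) \<in> K" "status K c (pos c) = 2"
  obtains q q' where "q \<noteq> q'" "adjacent (pos c) q" "adjacent (pos c) q'" "Cell c q \<in> K" "Cell c q' \<in> K"
    "represents k (pos(c := q)) reg \<or> approaches k c (pos(c := q)) reg"
    "represents k (pos(c := q')) reg \<or> approaches k c (pos(c := q')) reg"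
proof -
  obtain l d where position: "pos c = (l, d)" by fastforce
  have others: "pos c' = (reg c', 0)" if "c' < k" "c' \<noteq> c" for c'
    using assms(1) that by (simp add: approaches_def)
  have level: "Suc l = reg c \<or> l = Suc (reg c)"
    using assms(1) by (simp add: approaches_def position)
  have same_level: "approaches k c (pos(c := (l, d'))) reg" for d'
    using assms(1) by (simp add: approaches_def position)
  have dummy: "Cell c (l, Suc d) \<in> K" "adjacent (pos c) (l, Suc d)"
    using child_mem[of c l d] assms(4) by (simp_all add: position adjacent_def)
  show thesis
  proof (cases d)
    case 0
    have "Cell c (reg c, 0) \<in> K \<and> adjacent (pos c) (reg c, 0)"
    proof (cases "Suc l = reg c")
      case True
      then show ?thesis
        using upper_mem[of c l] assms(4) by (simp add: position 0 adjacent_def flip: True)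
    next
      case False
      then show ?thesis
        using parent_mem[of c "(l, 0)" "(reg c, 0)"] level assms(3) by (simp add: position 0 adjacent_def)
    qed
    moreover have "represents k (pos(c := (reg c, 0))) reg"
      using others by (simp add: represents_def)
    ultimately show thesis
      using that[of "(l, Suc d)" "(reg c, 0)"] dummy same_level by simp
  next
    case (Suc d')
    then have "Cell c (l, d') \<in> K" "adjacent (pos c) (l, d')"
      using parent_mem[of c "(l, d)" "(l, d')"] assms(3) by (simp_all add: position adjacent_def)
    then show thesis
      using that[of "(l, Suc d)" "(l, d')"] dummy same_level Suc by simp
  qed
qed

definition safe_position :: "cm_prog \<Rightarrow> nat \<Rightarrow> network \<Rightarrow> bool" where
  "safe_position P k G \<longleftrightarrow> (\<exists>kind ctl pos conf. arena k G kind ctl pos \<and> simulates k ctl pos conf \<and> \<not> halts P conf \<and>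
     (\<forall>y\<in>set (satellites k). 2 \<le> card (live G kind y)))"

lemma not_halted_if_not_halts: "\<not> halts P conf \<Longrightarrow> \<not> cm_halted P conf"
  unfolding halts_def by (metis cm_run_0)

lemma serves_unique: "serves a y \<Longrightarrow> serves a z \<Longrightarrow> y = z"
  by (cases a) auto

context arena
begin

lemma finite_live: "finite (live G kind y)"
  using finite_subset[OF active_nodes finite_nodes] by (simp add: live_def)

definition critical :: "satellite \<Rightarrow> bool" where
  "critical y \<longleftrightarrow> y \<in> set (satellites k) \<and> card (live G kind y) = 1 \<and>
     (\<forall>z\<in>set (satellites k). z \<noteq> y \<longrightarrow> 2 \<le> card (live G kind z))"

lemma safe_position_if_restored:
  assumes "critical y" "active G' = insert w (active G)" "w \<notin> active G" "serves (kind' w) y"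
    and "\<And>v. v \<in> active G \<Longrightarrow> kind' v = kind v"
    and "arena k G' kind' ctl' pos'" "simulates k ctl' pos' conf" "\<not> halts P conf"
  shows "safe_position P k G'"
proof -
  have "2 \<le> card (live G' kind' z)" if "z \<in> set (satellites k)" for z
  proof (cases "z = y")
    case True
    have "live G' kind' y = insert w (live G kind y)"
      using assms(2,4,5) by (auto simp: live_def)
    moreover have "w \<notin> live G kind y"
      using assms(3) by (simp add: live_def)
    ultimately show ?thesis
      using True finite_live assms(1) by (simp add: critical_def)
  next
    case False
    then have "live G' kind' z = live G kind z"
      using assms(2,4,5) serves_unique by (auto simp: live_def)
    then show ?thesis
      using assms(1) that False by (simp add: critical_def)
  qed
  then show ?thesis
    unfolding safe_position_def using assms(6-8) by blast
qed

lemma create_restores: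
  assumes "critical y" "c < k" "ctl \<in> set (controls (length P) k)" "reply P ctl (token_label c) y = Some s'"
    and "simulates k s' pos conf" "\<not> halts P conf"
  shows "\<exists>G'\<in>constructor_moves (game_rules P k) G. safe_position P k G'"
proof -
  obtain w where fresh: "w \<notin> nodes G" by (rule new_node)
  let ?kind = "kind(w := created kinds c (pos c) y)"
  obtain G' where move: "G' \<in> constructor_moves (game_rules P k) G"
    and created: "arena k G' ?kind s' pos" "active G' = insert w (active G)"
    using ex_create_move[OF assms(2) _ assms(3,4) fresh] assms(1) by (auto simp: critical_def)
  have "safe_position P k G'"
    by (rule safe_position_if_restored[OF assms(1) created(2) _ _ _ created(1) assms(5,6)])
      (use fresh active_nodes serves_created in auto)
  then show ?thesis
    using move by blast
qed

lemma shift_restores: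
  assumes "critical (opposite_side c (pos c))" "c < k" "status kinds c (pos c) = 2"
    and "v \<in> nodes G" "v \<notin> active G" "kind v = Cell c q" "adjacent (pos c) q"
    and "simulates k ctl (pos(c := q)) conf" "\<not> halts P conf"
  shows "\<exists>G'\<in>constructor_moves (game_rules P k) G. safe_position P k G'"
proof -
  obtain G' where move: "G' \<in> constructor_moves (game_rules P k) G"
    and shifted: "arena k G' kind ctl (pos(c := q))" "active G' = insert v (active G)"
    using ex_shift_move[OF assms(2-4,6,7)] by blast
  have "safe_position P k G'"
    by (rule safe_position_if_restored[OF assms(1) shifted(2) assms(5) _ _ shifted(1) assms(8,9)])
      (simp_all add: assms(6) side_adjacent[OF assms(7)])
  then show ?thesis
    using move by blast
qed

lemma ex_inactive_target:
  assumes "critical (opposite_side c (pos c))" "c < k" "status kinds c (pos c) = 2" "approaches k c pos reg"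
  obtains v q where "v \<in> nodes G" "v \<notin> active G" "kind v = Cell c q" "adjacent (pos c) q"
    "represents k (pos(c := q)) reg \<or> approaches k c (pos(c := q)) reg"
proof -
  obtain q q' where targets: "q \<noteq> q'" "adjacent (pos c) q" "adjacent (pos c) q'"
    "Cell c q \<in> kinds" "Cell c q' \<in> kinds"
    "represents k (pos(c := q)) reg \<or> approaches k c (pos(c := q)) reg"
    "represents k (pos(c := q')) reg \<or> approaches k c (pos(c := q')) reg"
    by (rule two_targets[OF assms(4,2) token_mem[OF assms(2)] assms(3)])
  then obtain v v' where nodes: "v \<in> nodes G" "kind v = Cell c q" "v' \<in> nodes G" "kind v' = Cell c q'"
    by auto
  have "v \<notin> active G \<or> v' \<notin> active G"
  proof (rule ccontr)
    assume "\<not> ?thesis"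
    then have "{v, v'} \<subseteq> live G kind (opposite_side c (pos c))"
      using nodes side_adjacent targets(2,3) by (auto simp: live_def)
    moreover have "v \<noteq> v'"
      using nodes targets(1) by auto
    ultimately show False
      using card_mono[OF finite_live, of "{v, v'}" "opposite_side c (pos c)"] assms(1) by (simp add: critical_def)
  qed
  then show thesis
    using that nodes targets by blast
qed

lemma reply_NoneD:
  assumes "reply P ctl (token_label c) (Parity c j) = None"
  shows "Parity c j = opposite_side c (pos c)" "status kinds c (pos c) = 2" "due ctl (token_label c)"
  using assms by (auto simp: opposite_side_def Suc_mod4_mod2 split: if_splits)

lemma move_restores_if_due:
  assumes "critical (opposite_side c (pos c))" "c < k" "status kinds c (pos c) = 2" "due ctl (token_label c)"
    and "simulates k ctl pos conf" "\<not> halts P conf"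
  shows "\<exists>G'\<in>constructor_moves (game_rules P k) G. safe_position P k G'"
proof -
  obtain pc reg where conf: "conf = (pc, reg)" "ctl = Shift pc c (reg c mod 4)" and approaching: "approaches k c pos reg"
    using assms(2,4,5) by (cases conf) (auto simp: represents_def)
  obtain v q where target: "v \<in> nodes G" "v \<notin> active G" "kind v = Cell c q" "adjacent (pos c) q"
    and "represents k (pos(c := q)) reg \<or> approaches k c (pos(c := q)) reg"
    by (rule ex_inactive_target[OF assms(1-3) approaching])
  then have "simulates k ctl (pos(c := q)) conf"
    using assms(2) by (auto simp: conf)
  then show ?thesis
    using shift_restores[OF assms(1-3) target _ assms(6)] by blast
qed

lemma repair:
  assumes critical: "critical y" and simulates: "simulates k ctl pos conf" and running: "\<not> halts P conf"
    and regs: "\<And>i. i \<in> set P \<Longrightarrow> instr_reg i < k"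
  shows "\<exists>G'\<in>constructor_moves (game_rules P k) G. safe_position P k G'"
proof -
  have control: "ctl \<in> set (controls (length P) k)"
    using simulates_controls[OF simulates] not_halted_if_not_halts[OF running] by (simp add: cm_halted_def)
  show ?thesis
  proof (cases y)
    case Clock
    obtain c s' conf' where progress: "c < k" "control_reply P ctl (token_label c) = Some s'"
        "simulates k s' pos conf'" "conf' = conf \<or> conf' = cm_step P conf"
      using control_progress[OF simulates regs not_halted_if_not_halts[OF running]] by metis
    then have "\<not> halts P conf'"
      using running by (auto simp: halts_step)
    then show ?thesis
      using create_restores[OF critical progress(1) control _ progress(3)] progress(2) Clock by simp
  next
    case (Parity c j)
    then have counter: "c < k"
      using critical by (auto simp: critical_def in_satellites)
    show ?thesis
    proof (cases "reply P ctl (token_label c) y")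
      case (Some s')
      then have "s' = ctl"
        using Parity by (auto split: if_splits)
      then show ?thesis
        using create_restores[OF critical counter control Some _ running] simulates by simp
    next
      case None
      note stuck = reply_NoneD[OF None[unfolded Parity]]
      then show ?thesis
        using move_restores_if_due[OF _ counter stuck(2,3) simulates running] critical Parity by simp
    qed
  qed
qed

lemma reply_to_deletion:
  assumes "\<And>y. y \<in> set (satellites k) \<Longrightarrow> 2 \<le> card (live G kind y)" "v \<notin> strong G"
    and "simulates k ctl pos conf" "\<not> halts P conf" "\<And>i. i \<in> set P \<Longrightarrow> instr_reg i < k"
  shows "net_connected (delete G v) \<and> (\<exists>G'\<in>constructor_moves (game_rules P k) (delete G v). safe_position P k G')"
proof -
  interpret deleted: arena k "delete G v" kind ctl pos
    by (rule arena_delete[OF assms(2)])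
  have one: "1 \<le> card (live (delete G v) kind y)" if "y \<in> set (satellites k)" for y
    using assms(1)[OF that] card_Diff_singleton_if[of "live G kind y" v] by (auto simp: live_delete)
  then have "net_connected (delete G v)"
    unfolding deleted.net_connected_iff by fastforce
  moreover have "\<exists>G'\<in>constructor_moves (game_rules P k) (delete G v). safe_position P k G'"
  proof (cases "\<exists>y\<in>set (satellites k). card (live (delete G v) kind y) < 2")
    case True
    then obtain y where cut: "y \<in> set (satellites k)" "card (live (delete G v) kind y) < 2" by blast
    then have "v \<in> live G kind y"
      using assms(1)[OF cut(1)] by (metis Diff_empty Diff_insert0 live_delete not_less)
    then have "live (delete G v) kind z = live G kind z" if "z \<noteq> y" for z
      using serves_unique that by (auto simp: live_def)
    then have "deleted.critical y"
      using cut one[OF cut(1)] assms(1) by (simp add: deleted.critical_def)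
    then show ?thesis
      using deleted.repair assms(3-5) by blast
  next
    case False
    then have "safe_position P k (delete G v)"
      unfolding safe_position_def using deleted.arena_axioms assms(3,4) by (meson not_less)
    then show ?thesis
      by (auto simp: constructor_moves_def)
  qed
  ultimately show ?thesis by blast
qed

end

lemma constructor_wins_if_runs_forever:
  assumes "safe_position P k G" and regs: "\<And>i. i \<in> set P \<Longrightarrow> instr_reg i < k"
  shows "constructor_wins_safety G (game_rules P k)"
proof (rule constructor_wins_safety_coinduct[where I = "safe_position P k"])
  show "safe_position P k G" by fact
next
  fix G G' assume safe: "safe_position P k G" and "G' \<in> destructor_moves G"
  then consider (skip) "G' = G" | (delete) v where "G' = delete G v" "v \<notin> strong G"
    by (auto simp: destructor_moves_eq)
  then show "net_connected G' \<and> (\<exists>G''\<in>constructor_moves (game_rules P k) G'. safe_position P k G'')"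
  proof cases
    case skip
    obtain kind ctl pos where "arena k G kind ctl pos" "\<And>y. y \<in> set (satellites k) \<Longrightarrow> 2 \<le> card (live G kind y)"
      using safe unfolding safe_position_def by blast
    then have "net_connected G"
      by (fastforce simp: arena.net_connected_iff)
    then show ?thesis
      using skip safe by (auto simp: constructor_moves_def)
  next
    case delete
    then show ?thesis
      using safe regs arena.reply_to_deletion unfolding safe_position_def by blast
  qed
qed

section \<open>Destructor wins if the machine halts\<close>

locale cramped_arena = arena +
  assumes few_live: "y \<in> set (satellites k) \<Longrightarrow> card (live G kind y) \<le> 2"

subsection \<open>Attacks\<close>

context arena
begin

lemma strong_servesE:
  assumes "v \<in> strong G" "serves (kind v) y"
  obtains c where "c < k" "kind v = Cell c (pos c)" "y = side c (pos c)"
proof -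
  have node: "v \<in> nodes G" "kind_strong pos (kind v)"
    using assms(1) by (auto simp: strong_eq)
  obtain c p where cell: "kind v = Cell c p"
    using assms(2) node(2) by (cases "kind v") auto
  then have "c < k"
    using node(1) cell_counter by (metis imageI)
  then show thesis
    using that[of c] cell node(2) assms(2) by simp
qed

lemma weak_Clock: "live G kind Clock \<inter> strong G = {}"
  by (auto simp: live_def side_def elim: strong_servesE)

lemma weak_opposite_side: "live G kind (opposite_side c (pos c)) \<inter> strong G = {}"
proof -
  have False if strong: "v \<in> strong G" "serves (kind v) (opposite_side c (pos c))" for v
  proof -
    obtain c' where sides: "opposite_side c (pos c) = side c' (pos c')"
      by (rule strong_servesE[OF strong])
    then have "c' = c"
      by (simp add: side_def opposite_side_def)
    then show False
      using sides side_neq_opposite_side[of c "pos c" c] by simp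
  qed
  then show ?thesis
    by (auto simp: live_def)
qed

lemma destructor_wins_if_one_weak:
  assumes "y \<in> set (satellites k)" "card (live G kind y) \<le> 1" "live G kind y \<inter> strong G = {}"
  shows "destructor_wins R G"
proof (cases "live G kind y = {}")
  case True
  then show ?thesis
    using assms(1) by (intro destructor_wins_disconnected) (auto simp: net_connected_iff)
next
  case False
  then have "card (live G kind y) = 1"
    using assms(2) card_gt_0_iff[of "live G kind y"] finite_live[of y] by linarith
  then obtain b where last: "live G kind y = {b}"
    by (rule card_1_singletonE)
  then have weak: "b \<in> active G" "b \<notin> strong G"
    using assms(3) by (auto simp: live_def)
  have "live (delete G b) kind y = {}"
    by (simp add: live_delete last)
  then have "\<not> net_connected (delete G b)"
    using arena.net_connected_iff[OF arena_delete[OF weak(2)]] assms(1) by blast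
  moreover have "delete G b \<in> destructor_moves G"
    using weak by (auto simp: destructor_moves_eq)
  ultimately show ?thesis
    using destructor_wins_disconnecting by blast
qed

end

context cramped_arena
begin

lemma cramped_if_replaced:
  assumes "arena k G' kind' ctl' pos'" "active G' = insert w (active G - {a})" "a \<in> live G kind y"
    and "serves (kind' w) y" "\<And>v. v \<in> active G \<Longrightarrow> kind' v = kind v"
  shows "cramped_arena k G' kind' ctl' pos'"
proof -
  interpret replaced: arena k G' kind' ctl' pos' by fact
  show ?thesis
  proof
    fix z assume z: "z \<in> set (satellites k)"
    show "card (live G' kind' z) \<le> 2"
    proof (cases "z = y")
      case True
      have "live G' kind' y = insert w (live G kind y - {a})"
        using assms(2,4,5) by (auto simp: live_def)
      moreover have "card (live G kind y - {a}) \<le> 1"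
        using True few_live[OF z] assms(3) by simp
      ultimately show ?thesis
        using True finite_live by (simp add: card_insert_if)
    next
      case False
      then have "live G' kind' z \<subseteq> live G kind z"
        using assms(2,4,5) serves_unique by (auto simp: live_def)
      then show ?thesis
        using few_live[OF z] card_mono[OF finite_live[of z]] by (meson order_trans)
    qed
  qed
qed

lemma destructor_wins_if_not_replaced:
  assumes "y \<in> set (satellites k)" "a \<in> live G kind y"
    and "arena k G' kind' ctl' pos'" "active G' = insert w (active G - {a})" "\<not> serves (kind' w) y"
    and "\<And>v. v \<in> active G \<Longrightarrow> kind' v = kind v" "live G kind y \<inter> strong G' = {}"
  shows "destructor_wins R G'"
proof -
  interpret new: arena k G' kind' ctl' pos' by fact
  have "live G' kind' y = live G kind y - {a}"
    using assms(4-6) by (auto simp: live_def)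
  moreover have "card (live G kind y - {a}) \<le> 1"
    using few_live[OF assms(1)] assms(2) by simp
  ultimately show ?thesis
    using new.destructor_wins_if_one_weak[OF assms(1)] assms(7) by (simp add: Diff_Int_distrib2)
qed

lemma create_replaces_or_loses:
  assumes "y \<in> set (satellites k)" "live G kind y \<inter> strong G = {}" "a \<in> live G kind y"
    and "arena k G' (kind(w := created kinds c (pos c) z)) s' pos" "w \<notin> nodes G"
    and "active G' = insert w (active G - {a})"
  shows "z = y \<and> cramped_arena k G' (kind(w := created kinds c (pos c) z)) s' pos \<or> destructor_wins R G'"
proof -
  let ?kind = "kind(w := created kinds c (pos c) z)"
  interpret created: arena k G' ?kind s' pos by fact
  have old: "?kind v = kind v" if "v \<in> active G" for v
    using that assms(5) active_nodes by auto
  have new: "serves (?kind w) x \<longleftrightarrow> x = z" for x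
    by (simp add: serves_created)
  have "live G kind y \<inter> strong G' = {}"
    using assms(2) old active_nodes by (force simp: live_def strong_eq created.strong_eq)
  then show ?thesis
    using cramped_if_replaced[OF assms(4,6,3)] destructor_wins_if_not_replaced[OF assms(1,3,4,6)] old new by auto
qed

lemma move_replaces_or_loses:
  assumes "y \<in> set (satellites k)" "live G kind y \<inter> strong G = {}" "a \<in> live G kind y"
    and "arena k G' kind ctl (pos(c := q))" "kind v = Cell c q" "active G' = insert v (active G - {a})"
  shows "side c q = y \<and> cramped_arena k G' kind ctl (pos(c := q)) \<or> destructor_wins R G'"
proof (cases "side c q = y")
  case True
  then have "cramped_arena k G' kind ctl (pos(c := q))"
    using cramped_if_replaced[OF assms(4,6,3)] by (simp add: assms(5))
  then show ?thesis
    using True by blast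
next
  case False
  interpret moved: arena k G' kind ctl "pos(c := q)" by fact
  have "u \<notin> strong G'" if "u \<in> live G kind y" for u
    using that assms(2) False active_nodes
    by (cases "kind u") (auto simp: live_def strong_eq moved.strong_eq split: if_splits)
  then show ?thesis
    using destructor_wins_if_not_replaced[OF assms(1,3,4,6)] False by (auto simp: assms(5))
qed

lemma attack:
  assumes satellite: "y \<in> set (satellites k)"
    and weak: "live G kind y \<inter> strong G = {}" and target: "a \<in> live G kind y"
    and create_wins: "\<And>G' c s' w. c < k \<Longrightarrow> reply P ctl (token_label c) y = Some s' \<Longrightarrow> w \<notin> nodes G \<Longrightarrow>
      cramped_arena k G' (kind(w := created kinds c (pos c) y)) s' pos \<Longrightarrow> nodes G' = insert w (nodes G) \<Longrightarrow>
      active G' = insert w (active G - {a}) \<Longrightarrow> destructor_wins (game_rules P k) G'"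
    and move_wins: "\<And>G' c v q. c < k \<Longrightarrow> status kinds c (pos c) = 2 \<Longrightarrow> v \<in> nodes G \<Longrightarrow> kind v = Cell c q \<Longrightarrow>
      adjacent (pos c) q \<Longrightarrow> side c q = y \<Longrightarrow> cramped_arena k G' kind ctl (pos(c := q)) \<Longrightarrow> nodes G' = nodes G \<Longrightarrow>
      active G' = insert v (active G - {a}) \<Longrightarrow> destructor_wins (game_rules P k) G'"
  shows "destructor_wins (game_rules P k) G"
proof (rule destructor_wins_forcing)
  have deletable: "a \<in> active G" "a \<notin> strong G"
    using target weak by (auto simp: live_def)
  then show "delete G a \<in> destructor_moves G"
    by (auto simp: destructor_moves_eq)
  interpret deleted: arena k "delete G a" kind ctl pos
    using arena_delete deletable by blast
  fix G' assume "G' \<in> constructor_moves (game_rules P k) (delete G a)"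
  then show "destructor_wins (game_rules P k) G'"
  proof (cases rule: deleted.constructor_moveE)
    case skip
    have "card (live G kind y - {a}) \<le> 1"
      using few_live[OF satellite] target by simp
    then show ?thesis
      using deleted.destructor_wins_if_one_weak[OF satellite] weak skip by (auto simp: live_delete)
  next
    case (create c z s' w)
    then show ?thesis
      using create_replaces_or_loses[OF satellite weak target, of G' w c z s' "game_rules P k"] create_wins[of c s' w G']
      by auto
  next
    case (move c v q)
    then show ?thesis
      using move_replaces_or_loses[OF satellite weak target, of G' c q v "game_rules P k"] move_wins[of c v q G']
      by auto
  qed
qed

lemma attack_Clock:
  assumes "\<And>G' kind' c s'. c < k \<Longrightarrow> control_reply P ctl (token_label c) = Some s' \<Longrightarrow>
    cramped_arena k G' kind' s' pos \<Longrightarrow> destructor_wins (game_rules P k) G'"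
  shows "destructor_wins (game_rules P k) G"
proof -
  have Clock: "Clock \<in> set (satellites k)"
    by (simp add: in_satellites)
  show ?thesis
  proof (cases "live G kind Clock = {}")
    case True
    then show ?thesis
      using destructor_wins_if_one_weak[OF Clock] weak_Clock by simp
  next
    case False
    then obtain a where target: "a \<in> live G kind Clock" by blast
    show ?thesis
    proof (rule attack[OF Clock weak_Clock target])
      fix G' c s' w
      assume "c < k" "reply P ctl (token_label c) Clock = Some s'"
        "cramped_arena k G' (kind(w := created kinds c (pos c) Clock)) s' pos"
      then show "destructor_wins (game_rules P k) G'"
        using assms by simp
    next
      fix c q assume "side c q = Clock"
      then show "destructor_wins (game_rules P k) G'" for G'
        by (simp add: side_def)
    qed
  qed
qed

lemma destructor_wins_if_stuck:
  assumes "\<And>c. c < k \<Longrightarrow> control_reply P ctl (token_label c) = None"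
  shows "destructor_wins (game_rules P k) G"
  by (rule attack_Clock) (use assms in simp)

lemma reply_opposite_sideD:
  assumes "due ctl (token_label c)" "reply P ctl (token_label c') (opposite_side c (pos c)) = Some s'"
  shows "c' = c" "s' = ctl" "status kinds c (pos c) < 2"
proof -
  show "c' = c" "s' = ctl"
    using assms(2) by (auto simp: opposite_side_def split: if_splits)
  then show "status kinds c (pos c) < 2"
    using assms status_le[of kinds c "pos c"] by (auto simp: opposite_side_def Suc_mod4_mod2 split: if_splits)
qed

text \<open>Destructor deletes a neighbour of the opposite satellite other than \<open>u\<close>.\<close>
lemma attack_opposite_side:
  assumes counter: "c < k" and due: "due ctl (token_label c)"
    and grow: "\<And>G' kind' w. status kinds c (pos c) < 2 \<Longrightarrow> cramped_arena k G' kind' ctl pos \<Longrightarrow>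
      status (kind' ` nodes G') c (pos c) = Suc (status kinds c (pos c)) \<Longrightarrow>
      w \<in> active G' \<Longrightarrow> kind' w = Cell c (next_child kinds c (pos c)) \<Longrightarrow>
      live G' kind' (side c (pos c)) \<subseteq> live G kind (side c (pos c)) \<Longrightarrow> destructor_wins (game_rules P k) G'"
    and move: "\<And>G' a v q. status kinds c (pos c) = 2 \<Longrightarrow> a \<in> live G kind (opposite_side c (pos c)) \<Longrightarrow> a \<noteq> u \<Longrightarrow>
      v \<in> nodes G \<Longrightarrow> kind v = Cell c q \<Longrightarrow> adjacent (pos c) q \<Longrightarrow> cramped_arena k G' kind ctl (pos(c := q)) \<Longrightarrow>
      nodes G' = nodes G \<Longrightarrow> active G' = insert v (active G - {a}) \<Longrightarrow> destructor_wins (game_rules P k) G'"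
  shows "destructor_wins (game_rules P k) G"
proof -
  let ?y = "opposite_side c (pos c)" and ?new = "Cell c (next_child kinds c (pos c))"
  note satellite = opposite_side_mem[OF counter, of "pos c"]
  show ?thesis
  proof (cases "live G kind ?y \<subseteq> {u}")
    case True
    then have "card (live G kind ?y) \<le> 1"
      using card_mono[of "{u}"] by force
    then show ?thesis
      using destructor_wins_if_one_weak[OF satellite] weak_opposite_side by blast
  next
    case False
    then obtain a where target: "a \<in> live G kind ?y" "a \<noteq> u" by blast
    show ?thesis
    proof (rule attack[OF satellite weak_opposite_side target(1)])
      fix G' c' s' w
      assume "reply P ctl (token_label c') ?y = Some s'"
      note reply = reply_opposite_sideD[OF due this]
      assume fresh: "w \<notin> nodes G" and arena: "cramped_arena k G' (kind(w := created kinds c' (pos c') ?y)) s' pos"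
        and nodes: "nodes G' = insert w (nodes G)" and active: "active G' = insert w (active G - {a})"
      have "cramped_arena k G' (kind(w := ?new)) ctl pos"
        using arena reply by (simp add: created_def)
      moreover have "status ((kind(w := ?new)) ` nodes G') c (pos c) = Suc (status kinds c (pos c))"
        unfolding nodes kinds_insert[OF fresh] using status_insert_next_child[OF reply(3)] by simp
      moreover have "live G' (kind(w := ?new)) (side c (pos c)) \<subseteq> live G kind (side c (pos c))"
        using active side_next_child[of c kinds "pos c"] side_neq_opposite_side[of c "pos c" c]
        by (auto simp: live_def)
      ultimately show "destructor_wins (game_rules P k) G'"
        using grow[of G' "kind(w := ?new)" w] reply(3) active by simp
    next
      fix G' c' v q
      assume "c' < k" "status kinds c' (pos c') = 2" "v \<in> nodes G" "kind v = Cell c' q" "adjacent (pos c') q"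
        "side c' q = ?y" "cramped_arena k G' kind ctl (pos(c' := q))" "nodes G' = nodes G"
        "active G' = insert v (active G - {a})"
      moreover from this have "c' = c"
        by (simp add: side_def opposite_side_def)
      ultimately show "destructor_wins (game_rules P k) G'"
        using move target by blast
    qed
  qed
qed

end

subsection \<open>Tokens under way\<close>

text \<open>If only the token serves its own satellite, then leaving the cell cuts that satellite off.\<close>
lemma destructor_wins_if_lone_token:
  assumes "cramped_arena k G kind ctl pos" "c < k" "due ctl (label_of ctl (kind ` nodes G) (Cell c (pos c)))"
    and "card (live G kind (side c (pos c))) \<le> 1"
  shows "destructor_wins (game_rules P k) G"
  using assms
proof (induction "2 - status (kind ` nodes G) c (pos c)" arbitrary: G kind rule: less_induct)
  case less
  interpret cramped_arena k G kind ctl pos by fact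
  show ?case
  proof (rule attack_opposite_side[OF less.prems(2,3)])
    fix G' kind'
    assume grown: "status kinds c (pos c) < 2" "cramped_arena k G' kind' ctl pos"
      and status: "status (kind' ` nodes G') c (pos c) = Suc (status kinds c (pos c))"
      and "live G' kind' (side c (pos c)) \<subseteq> live G kind (side c (pos c))"
    then have "card (live G' kind' (side c (pos c))) \<le> 1"
      using less.prems(4) card_mono[OF finite_live] by (meson order_trans)
    moreover have "due ctl (label_of ctl (kind' ` nodes G') (Cell c (pos c)))"
      using less.prems(3) by (cases ctl) auto
    ultimately show "destructor_wins (game_rules P k) G'"
      using less.hyps[of kind' G'] less.prems(2) grown status by simp
  next
    fix G' a v q
    assume target: "kind v = Cell c q" "adjacent (pos c) q" and moved: "cramped_arena k G' kind ctl (pos(c := q))"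
      and active: "active G' = insert v (active G - {a})"
    interpret moved: cramped_arena k G' kind ctl "pos(c := q)" by fact
    have neq: "side c q \<noteq> side c (pos c)"
      using side_adjacent[OF target(2)] side_neq_opposite_side by metis
    then have "live G' kind (side c (pos c)) \<subseteq> live G kind (side c (pos c))"
      using active target(1) by (auto simp: live_def)
    then have "card (live G' kind (side c (pos c))) \<le> 1"
      using less.prems(4) card_mono[OF finite_live] by (meson order_trans)
    moreover have False if "u \<in> strong G'" "serves (kind u) (side c (pos c))" for u
      by (rule moved.strong_servesE[OF that]) (use neq in \<open>auto simp: side_eq_iff split: if_splits\<close>)
    then have "live G' kind (side c (pos c)) \<inter> strong G' = {}"
      by (auto simp: live_def)
    ultimately show "destructor_wins (game_rules P k) G'"
      using moved.destructor_wins_if_one_weak[OF side_mem[OF less.prems(2)]] by blast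
  qed
qed

abbreviation dummy :: "position \<Rightarrow> position" where
  "dummy p \<equiv> (fst p, Suc (snd p))"

lemma approaches_adjacentE:
  assumes "approaches k c pos reg" "adjacent (pos c) q"
  obtains (deeper) "approaches k c (pos(c := q)) reg" "q = dummy (pos c)"
    | (retreat) "approaches k c (pos(c := q)) reg" "pos c = dummy q"
    | (arrived) "represents k (pos(c := q)) reg"
    | (overshot) "snd q = 0" "fst q mod 4 \<noteq> reg c mod 4" "fst q mod 4 mod 2 = reg c mod 4 mod 2"
proof -
  obtain l d l' d' where positions: "pos c = (l, d)" "q = (l', d')" by fastforce
  have others: "pos c' = (reg c', 0)" if "c' < k" "c' \<noteq> c" for c'
    using assms(1) that by (simp add: approaches_def)
  have level: "Suc l = reg c \<or> l = Suc (reg c)"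
    using assms(1) by (simp add: approaches_def positions)
  consider (same_level) "l' = l" "d' = Suc d \<or> d = Suc d'" | (reached) "d' = 0" "l' = reg c"
    | (beyond) "d' = 0" "l' = Suc (Suc (reg c)) \<or> reg c = Suc (Suc l')"
    using assms(2) level by (auto simp: adjacent_def positions)
  then show thesis
  proof cases
    case same_level
    then have "approaches k c (pos(c := q)) reg"
      using others level by (simp add: approaches_def positions)
    then show thesis
      using deeper retreat same_level by (auto simp: positions)
  next
    case reached
    then show thesis
      using arrived others by (simp add: represents_def positions)
  next
    case beyond
    have "Suc (Suc n) mod 4 \<noteq> n mod 4" "Suc (Suc n) mod 4 mod 2 = n mod 4 mod 2" for n :: nat
      unfolding mod4_mod2 by presburger simp
    then show thesis
      using overshot beyond unfolding positions by auto metis+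
  qed
qed

lemma destructor_wins_if_overshot:
  assumes "cramped_arena k G kind (Shift l c r) pos" "snd (pos c) = 0"
    and "fst (pos c) mod 4 \<noteq> r" "fst (pos c) mod 4 mod 2 = r mod 2"
  shows "destructor_wins (game_rules P k) G"
proof -
  interpret cramped_arena k G kind "Shift l c r" pos by fact
  show ?thesis
    by (rule destructor_wins_if_stuck) (use assms(2-4) in auto)
qed

locale under_way = cramped_arena k G kind "Shift l c (reg c mod 4)" pos for k l c reg G kind pos +
  assumes counter: "c < k" and approaching: "approaches k c pos reg"
begin

lemma token_due: "due (Shift l c (reg c mod 4)) (token_label c)"
  by (rule approaches_due(1)[OF approaching])

lemma under_way_if_approaches:
  assumes "cramped_arena k G' kind' (Shift l c (reg c mod 4)) pos'" "approaches k c pos' reg"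
  shows "under_way k l c reg G' kind' pos'"
  using assms counter by (simp add: under_way_def under_way_axioms_def)

lemma status_retreat:
  assumes "under_way k l c reg G' kind (pos(c := q))" "pos c = dummy q" "nodes G' = nodes G"
  shows "status (kind ` nodes G') c q = 2"
proof -
  interpret moved: under_way k l c reg G' kind "pos(c := q)" by fact
  show ?thesis
    using moved.status_child_mem[of c "fst q" "snd q"] token_mem[OF counter] assms(2,3) by simp
qed

end

context
  fixes P :: cm_prog and k l c :: nat and reg :: "nat \<Rightarrow> nat"
  assumes arrival_wins: "\<And>G kind pos. cramped_arena k G kind (Shift l c (reg c mod 4)) pos \<Longrightarrow>
      represents k pos reg \<Longrightarrow> destructor_wins (game_rules P k) G"
begin

lemma attack_under_way:
  assumes "under_way k l c reg G kind pos" and full: "status (kind ` nodes G) c (pos c) = 2"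
    and enter_wins: "\<And>G' a v. a \<in> live G kind (opposite_side c (pos c)) \<Longrightarrow> a \<noteq> u \<Longrightarrow> v \<in> nodes G \<Longrightarrow>
      kind v = Cell c (dummy (pos c)) \<Longrightarrow> under_way k l c reg G' kind (pos(c := dummy (pos c))) \<Longrightarrow>
      nodes G' = nodes G \<Longrightarrow> active G' = insert v (active G - {a}) \<Longrightarrow> destructor_wins (game_rules P k) G'"
    and retreat_wins: "\<And>G' v q. pos c = dummy q \<Longrightarrow> under_way k l c reg G' kind (pos(c := q)) \<Longrightarrow>
      status (kind ` nodes G') c q = 2 \<Longrightarrow> v \<in> active G' \<Longrightarrow> kind v = Cell c (pos c) \<Longrightarrow>
      destructor_wins (game_rules P k) G'"
  shows "destructor_wins (game_rules P k) G"
proof -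
  interpret under_way k l c reg G kind pos by fact
  show ?thesis
  proof (rule attack_opposite_side[OF counter token_due, where u = u])
    fix G' a v q
    assume deleted: "a \<in> live G kind (opposite_side c (pos c))" "a \<noteq> u"
      and target: "v \<in> nodes G" "kind v = Cell c q" "adjacent (pos c) q"
      and moved: "cramped_arena k G' kind (Shift l c (reg c mod 4)) (pos(c := q))"
      and nodes: "nodes G' = nodes G" and active: "active G' = insert v (active G - {a})"
    show "destructor_wins (game_rules P k) G'"
      using approaching target(3)
    proof (cases rule: approaches_adjacentE)
      case deeper
      then show ?thesis
        using enter_wins[OF deleted target(1) _ _ nodes active] target(2) under_way_if_approaches[OF moved] by simp
    next
      case retreat
      note returned = under_way_if_approaches[OF moved retreat(1)]
      obtain b where token: "b \<in> nodes G" "kind b = Cell c (pos c)"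
        by (rule token_node[OF counter])
      then have "b \<in> strong G" "a \<notin> strong G"
        using deleted(1) weak_opposite_side[of c] by (auto simp: strong_eq)
      then have "b \<in> active G'"
        using active strong_active by auto
      then show ?thesis
        using retreat_wins[OF retreat(2) returned status_retreat[OF returned retreat(2) nodes] _ token(2)] by simp
    next
      case arrived
      then show ?thesis
        by (rule arrival_wins[OF moved])
    next
      case overshot
      then show ?thesis
        using destructor_wins_if_overshot[OF moved] by simp
    qed
  qed (use full in simp)
qed

text \<open>Destructor spares the active dummy \<open>u\<close>. A token entering it is alone at its satellite; so the token can only
  return to its parent, whose dummy is the cell just left, or leave the level.\<close>
lemma destructor_wins_if_active_dummy:
  assumes "under_way k l c reg G kind pos" "status (kind ` nodes G) c (pos c) = 2"
    and "u \<in> active G" "kind u = Cell c (dummy (pos c))"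
  shows "destructor_wins (game_rules P k) G"
  using assms
proof (induction "snd (pos c)" arbitrary: G pos u rule: less_induct)
  case less
  interpret under_way k l c reg G kind pos by fact
  let ?y = "opposite_side c (pos c)"
  have spared: "u \<in> nodes G" "u \<in> live G kind ?y"
    using less.prems(3,4) active_nodes by (auto simp: live_def side_def opposite_side_def)
  show ?case
  proof (rule attack_under_way[OF less.prems(1,2), where u = u])
    fix G' a v
    assume deleted: "a \<in> live G kind ?y" "a \<noteq> u" and entered: "v \<in> nodes G" "kind v = Cell c (dummy (pos c))"
      and moved: "under_way k l c reg G' kind (pos(c := dummy (pos c)))"
      and active: "active G' = insert v (active G - {a})"
    interpret moved: under_way k l c reg G' kind "pos(c := dummy (pos c))" by fact
    have "v = u"
      using kind_inj[OF entered(1) spared(1)] entered(2) less.prems(4) by simp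
    moreover have "live G kind ?y = {a, u}"
      using few_live[OF opposite_side_mem[OF counter], of "pos c"] deleted spared(2) finite_live[of ?y]
        card_seteq[of "live G kind ?y" "{a, u}"] by auto
    moreover have "side c (dummy (pos c)) = ?y"
      by (simp add: side_def opposite_side_def)
    ultimately have "live G' kind (side c (dummy (pos c))) \<subseteq> {u}"
      using active by (auto simp: live_def)
    then have "card (live G' kind (side c (dummy (pos c)))) \<le> 1"
      using card_mono[of "{u}"] by force
    then show "destructor_wins (game_rules P k) G'"
      using destructor_wins_if_lone_token[OF moved.cramped_arena_axioms counter moved.token_due] by simp
  next
    fix G' v q
    assume "pos c = dummy q" "under_way k l c reg G' kind (pos(c := q))" "status (kind ` nodes G') c q = 2"
      "v \<in> active G'" "kind v = Cell c (pos c)"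
    then show "destructor_wins (game_rules P k) G'"
      using less.hyps[of "pos(c := q)" G' v] by simp
  qed
qed

lemma destructor_wins_if_growing:
  assumes "under_way k l c reg G kind pos" "status (kind ` nodes G) c (pos c) < 2"
  shows "destructor_wins (game_rules P k) G"
  using assms
proof (induction "2 - status (kind ` nodes G) c (pos c)" arbitrary: G kind rule: less_induct)
  case less
  interpret under_way k l c reg G kind pos by fact
  show ?case
  proof (rule attack_opposite_side[OF counter token_due])
    fix G' kind' w
    assume "cramped_arena k G' kind' (Shift l c (reg c mod 4)) pos"
      and status: "status (kind' ` nodes G') c (pos c) = Suc (status kinds c (pos c))"
      and created: "w \<in> active G'" "kind' w = Cell c (next_child kinds c (pos c))"
    then have grown: "under_way k l c reg G' kind' pos"
      using under_way_if_approaches approaching by blast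
    show "destructor_wins (game_rules P k) G'"
    proof (cases "status kinds c (pos c) = 1")
      case True
      then have "next_child kinds c (pos c) = dummy (pos c)"
        by (metis next_child.simps one_neq_zero prod.collapse)
      then show ?thesis
        using destructor_wins_if_active_dummy[OF grown _ created(1)] True status created(2) by simp
    next
      case False
      then show ?thesis
        using less.hyps[OF _ grown] status less.prems(2) by simp
    qed
  qed (use less.prems(2) in auto)
qed

text \<open>Constructor can delay by descending into the dummies, but only to the end of their chain.\<close>
lemma destructor_wins_if_depth_bounded:
  assumes "under_way k l c reg G kind pos" "\<And>p. Cell c p \<in> kind ` nodes G \<Longrightarrow> snd p \<le> D"
  shows "destructor_wins (game_rules P k) G"
  using assms
proof (induction "D - snd (pos c)" arbitrary: G pos rule: less_induct)
  case less
  interpret under_way k l c reg G kind pos by fact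
  consider (growing) "status kinds c (pos c) < 2" | (full) "status kinds c (pos c) = 2"
    using status_le[of kinds c "pos c"] by linarith
  then show ?case
  proof cases
    case growing
    then show ?thesis
      by (rule destructor_wins_if_growing[OF less.prems(1)])
  next
    case full
    then show ?thesis
    proof (rule attack_under_way[OF less.prems(1)])
      fix G' v
      assume entered: "v \<in> nodes G" "kind v = Cell c (dummy (pos c))"
        and moved: "under_way k l c reg G' kind (pos(c := dummy (pos c)))" and nodes: "nodes G' = nodes G"
      have "snd (dummy (pos c)) \<le> D"
        using less.prems(2) entered by (metis imageI)
      then show "destructor_wins (game_rules P k) G'"
        using less.hyps[OF _ moved] less.prems(2) nodes by simp
    next
      fix G' v q
      assume "pos c = dummy q" "under_way k l c reg G' kind (pos(c := q))" "status (kind ` nodes G') c q = 2"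
        "v \<in> active G'" "kind v = Cell c (pos c)"
      then show "destructor_wins (game_rules P k) G'"
        using destructor_wins_if_active_dummy[of G' kind "pos(c := q)" v] by simp
    qed
  qed
qed

lemma destructor_wins_if_under_way:
  assumes "under_way k l c reg G kind pos"
  shows "destructor_wins (game_rules P k) G"
proof -
  interpret under_way k l c reg G kind pos by fact
  have "finite {p. Cell c p \<in> kinds}"
    using finite_nodes by (auto intro!: finite_vimageI[of kinds "Cell c", unfolded vimage_def] simp: inj_def)
  then obtain D where "\<And>p. Cell c p \<in> kinds \<Longrightarrow> snd p \<le> D"
    using finite_nat_set_iff_bounded_le[of "snd ` {p. Cell c p \<in> kinds}"] by blast
  then show ?thesis
    by (rule destructor_wins_if_depth_bounded[OF assms])
qed

end

subsection \<open>Simulation\<close>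

lemma attack_at_rest:
  assumes "cramped_arena k G kind (At pc) pos" "represents k pos reg"
    and next_step: "\<And>G' kind' s'. pc < length P \<Longrightarrow> cramped_arena k G' kind' s' pos \<Longrightarrow>
      simulates k s' pos (cm_step P (pc, reg)) \<Longrightarrow> destructor_wins (game_rules P k) G'"
  shows "destructor_wins (game_rules P k) G"
proof -
  interpret cramped_arena k G kind "At pc" pos by fact
  show ?thesis
  proof (rule attack_Clock)
    fix G' kind' c s'
    assume counter: "c < k" and reply: "control_reply P (At pc) (token_label c) = Some s'"
      and replied: "cramped_arena k G' kind' s' pos"
    have token: "pos c = (reg c, 0)"
      using assms(2) counter by (simp add: represents_def)
    have instr: "pc < length P" "c = instr_reg (P ! pc)" "s' = next_control P (pc, reg)"
      using reply unfolding token control_reply_At by (simp_all split: if_splits del: next_control.simps)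
    show "destructor_wins (game_rules P k) G'"
      using next_step[OF instr(1) replied] simulates_next_control[OF assms(2) instr(1)] counter instr(2,3) by simp
  qed
qed

lemma attack_arrived:
  assumes "cramped_arena k G kind (Shift l c (reg c mod 4)) pos" "represents k pos reg"
    and rest_wins: "\<And>G' kind'. cramped_arena k G' kind' (At l) pos \<Longrightarrow> destructor_wins (game_rules P k) G'"
  shows "destructor_wins (game_rules P k) G"
proof -
  interpret cramped_arena k G kind "Shift l c (reg c mod 4)" pos by fact
  show ?thesis
  proof (rule attack_Clock)
    fix G' kind' c' s'
    assume "c' < k" "control_reply P (Shift l c (reg c mod 4)) (token_label c') = Some s'"
      and replied: "cramped_arena k G' kind' s' pos"
    then have "s' = At l"
      using assms(2) by (auto simp: represents_def split: if_splits)
    then show "destructor_wins (game_rules P k) G'"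
      using rest_wins replied by simp
  qed
qed

lemma destructor_wins_if_rest_wins:
  assumes "cramped_arena k G kind s pos" "simulates k s pos (pc, reg)"
    and rest_wins: "\<And>G kind pos. cramped_arena k G kind (At pc) pos \<Longrightarrow> represents k pos reg \<Longrightarrow>
      destructor_wins (game_rules P k) G"
  shows "destructor_wins (game_rules P k) G"
proof -
  have arrival_wins: "destructor_wins (game_rules P k) G"
    if "cramped_arena k G kind (Shift pc c (reg c mod 4)) pos" "represents k pos reg" for c G kind pos
    by (rule attack_arrived[OF that]) (rule rest_wins[OF _ that(2)])
  from assms(2) consider (rest) "s = At pc" "represents k pos reg"
    | (arrived) c where "s = Shift pc c (reg c mod 4)" "represents k pos reg"
    | (under_way) c where "c < k" "s = Shift pc c (reg c mod 4)" "approaches k c pos reg"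
    by auto
  then show ?thesis
  proof cases
    case rest
    then show ?thesis
      using rest_wins assms(1) by blast
  next
    case arrived
    then show ?thesis
      using arrival_wins assms(1) by blast
  next
    case (under_way c)
    then have "under_way k pc c reg G kind pos"
      using assms(1) by (simp add: under_way_def under_way_axioms_def)
    then show ?thesis
      using destructor_wins_if_under_way arrival_wins by blast
  qed
qed

lemma destructor_wins_if_halts:
  assumes "cramped_arena k G kind s pos" "simulates k s pos conf" "halts P conf"
  shows "destructor_wins (game_rules P k) G"
proof -
  obtain t where "cm_halted P (cm_run P t conf)"
    using assms(3) by (auto simp: halts_def)
  then show ?thesis
    using assms(1,2)
  proof (induction t arbitrary: G kind s pos conf rule: less_induct)
    case (less t)
    obtain pc reg where conf: "conf = (pc, reg)" by fastforce
    show ?case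
    proof (rule destructor_wins_if_rest_wins[OF less.prems(2) less.prems(3)[unfolded conf]])
      fix G kind pos
      assume "cramped_arena k G kind (At pc) pos" "represents k pos reg"
      then show "destructor_wins (game_rules P k) G"
      proof (rule attack_at_rest)
        fix G' kind' s'
        assume "pc < length P"
          and replied: "cramped_arena k G' kind' s' pos" "simulates k s' pos (cm_step P (pc, reg))"
        then obtain t' where time: "t = Suc t'"
          using less.prems(1) by (cases t) (auto simp: conf cm_halted_def)
        show "destructor_wins (game_rules P k) G'"
          using less.IH[OF _ _ replied, of t'] less.prems(1) by (simp add: time cm_run_Suc conf)
      qed
    qed
  qed
qed

section \<open>The initial network\<close>

definition core_kinds :: "nat \<Rightarrow> kind list" where
  "core_kinds k = Hub # map Satellite (satellites k) @ map (\<lambda>c. Cell c (0, 0)) [1..<k]"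

definition connector_kinds :: "nat \<Rightarrow> kind list" where
  "connector_kinds k = map (\<lambda>y. Connector y Hub) (satellites k @ Clock # map (\<lambda>c. Parity c 1) [0..<k])"

definition fixed_kinds :: "nat \<Rightarrow> kind list" where
  "fixed_kinds k = core_kinds k @ connector_kinds k"

definition path_start :: "nat \<Rightarrow> nat" where
  "path_start k = length (fixed_kinds k)"

definition init_kind :: "nat \<Rightarrow> nat \<Rightarrow> kind" where
  "init_kind k v = (if v < path_start k then fixed_kinds k ! v else Cell 0 (v - path_start k, 0))"

definition init_size :: "nat \<Rightarrow> nat \<Rightarrow> nat" where
  "init_size k x = path_start k + 4 * x + 2"

abbreviation init_kinds :: "nat \<Rightarrow> nat \<Rightarrow> kind set" where
  "init_kinds k x \<equiv> init_kind k ` {..<init_size k x}"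

definition init_pos :: "nat \<Rightarrow> nat \<Rightarrow> position" where
  "init_pos x c = (snd (cm_init (4 * x)) c, 0)"

text \<open>Register 0 starts with \<open>4 * x\<close>: the labels along the path have period 4, so the code of the network is a sum
  over \<open>j < x\<close> of a fixed expression.\<close>
definition init_net :: "nat \<Rightarrow> nat \<Rightarrow> network" where
  "init_net k x = \<lparr>nodes = {..<init_size k x},
     edges = {(u, v). u < init_size k x \<and> v < init_size k x \<and> linked (init_kind k u) (init_kind k v)},
     active = insert (path_start k + 4 * x) {..<path_start k},
     strong = insert (path_start k + 4 * x) {..<length (core_kinds k)},
     lab = (\<lambda>v. if v < init_size k x then to_nat (label_of (At 0) (init_kinds k x) (init_kind k v)) else 0)\<rparr>"

lemma init_net_simps [simp]:
  "nodes (init_net k x) = {..<init_size k x}"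
  "edges (init_net k x) =
     {(u, v). u < init_size k x \<and> v < init_size k x \<and> linked (init_kind k u) (init_kind k v)}"
  "active (init_net k x) = insert (path_start k + 4 * x) {..<path_start k}"
  "strong (init_net k x) = insert (path_start k + 4 * x) {..<length (core_kinds k)}"
  by (simp_all add: init_net_def)

lemma distinct_satellites: "distinct (satellites k)"
proof (induction k)
  case (Suc k)
  have "satellites (Suc k) = satellites k @ [Parity k 0, Parity k 1]"
    by (simp add: satellites_def)
  then show ?case
    using Suc by (auto simp: in_satellites)
qed (simp add: satellites_def)

lemma distinct_core_kinds: "distinct (core_kinds k)"
  using distinct_satellites by (auto simp: core_kinds_def distinct_map inj_on_def)

lemma set_core_kinds:
  "set (core_kinds k) = insert Hub (Satellite ` set (satellites k) \<union> {Cell c (0, 0) |c. 0 < c \<and> c < k})"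
  by (auto simp: core_kinds_def Suc_le_eq)

lemma init_kind_core: "v < length (core_kinds k) \<Longrightarrow> init_kind k v = core_kinds k ! v"
  by (simp add: init_kind_def path_start_def fixed_kinds_def nth_append)

lemma init_kind_connector:
  assumes "length (core_kinds k) \<le> v" "v < path_start k"
  shows "is_Connector (init_kind k v)"
proof -
  have "init_kind k v \<in> set (connector_kinds k)"
    using assms by (simp add: init_kind_def path_start_def fixed_kinds_def nth_append)
  then show ?thesis
    by (auto simp: connector_kinds_def)
qed

lemma init_kind_path [simp]: "init_kind k (path_start k + i) = Cell 0 (i, 0)"
  by (simp add: init_kind_def)

lemma init_kindE:
  assumes "v < init_size k x"
  obtains (core) "v < length (core_kinds k)" "init_kind k v = core_kinds k ! v"
      "init_kind k v \<in> set (core_kinds k)"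
    | (connector) "length (core_kinds k) \<le> v" "v < path_start k" "is_Connector (init_kind k v)"
    | (path) i where "i \<le> 4 * x + 1" "v = path_start k + i" "init_kind k v = Cell 0 (i, 0)"
proof -
  consider "v < length (core_kinds k)" | "length (core_kinds k) \<le> v" "v < path_start k"
    | (beyond) "path_start k \<le> v"
    by linarith
  then show thesis
  proof cases
    case beyond
    then show thesis
      using path[of "v - path_start k"] assms by (simp add: init_size_def init_kind_def)
  qed (use core connector init_kind_core init_kind_connector nth_mem in metis)+
qed

lemma init_kinds_eq:
  "init_kinds k x = set (core_kinds k) \<union> set (connector_kinds k) \<union> {Cell 0 (i, 0) |i. i \<le> 4 * x + 1}"
proof -
  have nodes: "{..<init_size k x} = {..<path_start k} \<union> (+) (path_start k) ` {0..4 * x + 1}"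
    unfolding image_add_atLeastAtMost by (auto simp: init_size_def)
  have fixed: "init_kind k ` {..<path_start k} = set (fixed_kinds k)"
    by (auto simp: init_kind_def path_start_def in_set_conv_nth image_iff)
  have path: "init_kind k ` (+) (path_start k) ` {0..4 * x + 1} = {Cell 0 (i, 0) |i. i \<le> 4 * x + 1}"
    unfolding image_image by auto
  show ?thesis
    unfolding nodes image_Un fixed path by (simp add: fixed_kinds_def)
qed

lemma Cell_mem_init_kinds: "Cell c p \<in> init_kinds k x \<longleftrightarrow>
    snd p = 0 \<and> (c = 0 \<and> fst p \<le> 4 * x + 1 \<or> 0 < c \<and> c < k \<and> fst p = 0)"
  unfolding init_kinds_eq by (cases p) (auto simp: set_core_kinds connector_kinds_def)

lemma init_layout:
  assumes "0 < k"
  shows "layout k (init_kinds k x)"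
proof
  show "Hub \<in> init_kinds k x" "\<And>y. Satellite y \<in> init_kinds k x \<longleftrightarrow> y \<in> set (satellites k)"
    unfolding init_kinds_eq by (auto simp: set_core_kinds connector_kinds_def)
  show "t \<in> init_kinds k x" if "Connector y t \<in> init_kinds k x" for y t
    using that unfolding init_kinds_eq by (auto simp: set_core_kinds connector_kinds_def)
  show "c < k" if "Cell c p \<in> init_kinds k x" for c p
    using that assms by (auto simp: Cell_mem_init_kinds)
  show "Cell c p \<in> init_kinds k x" if "Cell c q \<in> init_kinds k x" "is_child p q" for c p q
    using that by (cases p; cases q) (auto simp: Cell_mem_init_kinds)
qed (simp add: Cell_mem_init_kinds)

lemma init_kind_inj:
  assumes "u < init_size k x" "v < init_size k x" "init_kind k u = init_kind k v" "\<not> is_Connector (init_kind k u)"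
  shows "u = v"
proof -
  have not_core: "Cell 0 (i, 0) \<notin> set (core_kinds k)" for i
    by (auto simp: set_core_kinds)
  show ?thesis
    using assms(1)
  proof (cases rule: init_kindE)
    case u_core: core
    show ?thesis
      using assms(2)
    proof (cases rule: init_kindE)
      case core
      then show ?thesis
        using u_core assms(3) nth_eq_iff_index_eq[OF distinct_core_kinds] by metis
    next
      case path
      then show ?thesis
        using u_core(3) assms(3) not_core by simp
    qed (use assms(3,4) in simp)
  next
    case u_path: (path i)
    show ?thesis
      using assms(2)
    proof (cases rule: init_kindE)
      case core
      then show ?thesis
        using u_path(3) assms(3) not_core by metis
    next
      case path
      then show ?thesis
        using u_path assms(3) by simp
    qed (use assms(3,4) in simp)
  qed (use assms(4) in simp)
qed

lemma init_strong:
  "strong (init_net k x) = {v \<in> nodes (init_net k x). kind_strong (init_pos x) (init_kind k v)}"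
proof -
  have core: "length (core_kinds k) \<le> path_start k"
    by (simp add: path_start_def fixed_kinds_def)
  have strong_iff: "v \<in> strong (init_net k x) \<longleftrightarrow> kind_strong (init_pos x) (init_kind k v)"
    if "v < init_size k x" for v
    using that
  proof (cases rule: init_kindE)
    case core
    then have "kind_strong (init_pos x) (init_kind k v)"
      by (auto simp: set_core_kinds init_pos_def cm_init_def)
    then show ?thesis
      using core by simp
  next
    case connector
    then show ?thesis
      by (cases "init_kind k v") auto
  next
    case (path i)
    then show ?thesis
      using core by (auto simp: init_pos_def cm_init_def)
  qed
  have "strong (init_net k x) \<subseteq> {..<init_size k x}"
    using core by (auto simp: init_size_def)
  then show ?thesis
    using strong_iff unfolding init_net_simps(1) by blast
qed

lemma init_arena:
  assumes "0 < k"
  shows "arena k (init_net k x) (init_kind k) (At 0) (init_pos x)"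
proof -
  interpret layout k "init_kind k ` nodes (init_net k x)"
    using init_layout[OF assms] by simp
  show ?thesis
  proof
    show "u = v" if "u \<in> nodes (init_net k x)" "v \<in> nodes (init_net k x)" "init_kind k u = init_kind k v"
      "\<not> is_Connector (init_kind k u)" for u v
      using that init_kind_inj by simp
    show "strong (init_net k x) = {v \<in> nodes (init_net k x). kind_strong (init_pos x) (init_kind k v)}"
      by (rule init_strong)
    show "Cell c (init_pos x c) \<in> init_kind k ` nodes (init_net k x)" if "c < k" for c
      using that by (simp add: Cell_mem_init_kinds init_pos_def cm_init_def)
  qed (auto simp: init_net_def init_size_def path_start_def fixed_kinds_def)
qed

lemma length_filter_eq: "distinct xs \<Longrightarrow> length (filter (\<lambda>x. x = a) xs) = of_bool (a \<in> set xs)"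
  by (induction xs) auto

lemma length_filter_serves_fixed_kinds:
  assumes "y \<in> set (satellites k)"
  shows "length (filter (\<lambda>a. serves a y) (fixed_kinds k)) = 2 - of_bool (y = Parity 0 0)"
proof -
  have "length (filter (\<lambda>a. serves a y) (fixed_kinds k)) = length (filter (\<lambda>c. Parity c 0 = y) [1..<k]) +
      length (filter (\<lambda>z. z = y) (satellites k)) + of_bool (y = Clock) +
      length (filter (\<lambda>c. Parity c 1 = y) [0..<k])"
    by (auto simp: fixed_kinds_def core_kinds_def connector_kinds_def filter_map comp_def side_def)
  moreover have "length (filter (\<lambda>z. z = y) (satellites k)) = 1"
    using assms by (simp add: length_filter_eq[OF distinct_satellites])
  moreover have "length (filter (\<lambda>c. Parity c 0 = y) [1..<k]) + of_bool (y = Clock) +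
      length (filter (\<lambda>c. Parity c 1 = y) [0..<k]) = 1 - of_bool (y = Parity 0 0)"
  proof -
    consider "y = Clock" | c where "c < k" "y = Parity c 0" | c where "c < k" "y = Parity c 1"
      using assms by (auto simp: in_satellites less_2_cases_iff)
    then show ?thesis
      by cases (auto simp: length_filter_eq)
  qed
  ultimately show ?thesis
    by simp
qed

lemma init_card_live:
  assumes "0 < k" "y \<in> set (satellites k)"
  shows "card (live (init_net k x) (init_kind k) y) = 2"
proof -
  have "card (live (init_net k x) (init_kind k) y) =
      card ({v. v < length (fixed_kinds k) \<and> serves (fixed_kinds k ! v) y} \<union>
        {v. v = path_start k + 4 * x \<and> y = Parity 0 0})"
    by (rule arg_cong[where f = card]) (auto simp: live_def init_kind_def path_start_def side_def)
  also have "\<dots> = card {v. v < length (fixed_kinds k) \<and> serves (fixed_kinds k ! v) y} +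
      card {v. v = path_start k + 4 * x \<and> y = Parity 0 0}"
    by (rule card_Un_disjoint) (auto simp: path_start_def)
  also have "card {v. v < length (fixed_kinds k) \<and> serves (fixed_kinds k ! v) y} =
      length (filter (\<lambda>a. serves a y) (fixed_kinds k))"
    by (rule length_filter_conv_card[symmetric])
  also have "card {v. v = path_start k + 4 * x \<and> y = Parity 0 0} = of_bool (y = Parity 0 0)"
    by simp
  finally show ?thesis
    using length_filter_serves_fixed_kinds[OF assms(2)] by simp
qed

lemma init_safety_instance:
  assumes "0 < k"
  shows "safety_instance (init_net k x) R"
proof -
  interpret arena k "init_net k x" "init_kind k" "At 0" "init_pos x"
    using init_arena[OF assms] .
  have "net_connected (init_net k x)"
    unfolding net_connected_iff using init_card_live[OF assms, of _ x] by (metis card.empty zero_neq_numeral)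
  moreover have "wf_network (init_net k x)"
    unfolding wf_network_def
  proof (intro conjI allI impI)
    show "(v, u) \<in> edges (init_net k x)" if "(u, v) \<in> edges (init_net k x)" for u v
      using that linked_sym[of "init_kind k u"] by simp
    show "lab (init_net k x) v = 0" if "v \<notin> nodes (init_net k x)" for v
      using that by (simp add: init_net_def)
  qed (use active_nodes strong_active in \<open>auto simp: linked_irrefl\<close>)
  ultimately show ?thesis
    by (simp add: safety_instance_def)
qed

lemma constructor_wins_init_net_iff:
  assumes "0 < k" "\<And>i. i \<in> set P \<Longrightarrow> instr_reg i < k"
  shows "constructor_wins_safety (init_net k x) (game_rules P k) \<longleftrightarrow> \<not> halts P (cm_init (4 * x))"
proof -
  interpret cramped_arena k "init_net k x" "init_kind k" "At 0" "init_pos x"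
    using init_arena[OF assms(1)] init_card_live[OF assms(1)]
    by (simp add: cramped_arena_def cramped_arena_axioms_def)
  have sim: "simulates k (At 0) (init_pos x) (cm_init (4 * x))"
    by (simp add: cm_init_def represents_def init_pos_def)
  show ?thesis
  proof
    assume "\<not> halts P (cm_init (4 * x))"
    then have "safe_position P k (init_net k x)"
      unfolding safe_position_def using arena_axioms sim init_card_live[OF assms(1), of _ x] by (metis order_refl)
    then show "constructor_wins_safety (init_net k x) (game_rules P k)"
      by (rule constructor_wins_if_runs_forever) (rule assms(2))
  qed (use destructor_wins_if_halts[OF cramped_arena_axioms sim] in blast)
qed

section \<open>The code of the initial network\<close>

lemma sum_lessThan_add: "(\<Sum>v<a + b. f v) = (\<Sum>v<a. f v) + (\<Sum>i<b. f (a + i))" for f :: "nat \<Rightarrow> nat"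
  by (induction b) (simp_all add: add.assoc)

lemma sum_blocks_of_4:
  "(\<Sum>i<4 * x. f i) = (\<Sum>j<x. f (4 * j) + f (4 * j + 1) + f (4 * j + 2) + f (4 * j + 3))" for f :: "nat \<Rightarrow> nat"
  by (induction x) (simp_all add: eval_nat_numeral)

lemma sum_init_size:
  "(\<Sum>v<init_size k x. f v) = (\<Sum>v<Suc (path_start k). f v) + (\<Sum>i<4 * x. f (path_start k + Suc i)) +
     f (path_start k + Suc (4 * x))" for f :: "nat \<Rightarrow> nat"
  using sum_lessThan_add[of f "Suc (path_start k)" "4 * x + 1"] by (simp add: init_size_def)

lemma set_encode_image: "inj_on f A \<Longrightarrow> set_encode (f ` A) = (\<Sum>a\<in>A. 2 ^ f a)"
  by (simp add: set_encode_def sum.reindex)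

definition edge_code :: "nat \<times> nat \<Rightarrow> nat" where
  "edge_code = (\<lambda>(u, v). 2 ^ prod_encode (u, v) + 2 ^ prod_encode (v, u))"

lemma set_encode_edges:
  assumes "\<And>u v. E u v \<longleftrightarrow> E v u" "\<And>u. \<not> E u u"
  shows "set_encode (prod_encode ` {(u, v). u < n \<and> v < n \<and> E u v}) =
    (\<Sum>v<n. \<Sum>u | u < v \<and> E u v. edge_code (u, v))"
proof -
  have "(\<Sum>p | fst p < n \<and> snd p < n \<and> E (fst p) (snd p). g p) = (\<Sum>v<n. \<Sum>u | u < v \<and> E u v. g (u, v) + g (v, u))"
    for g :: "nat \<times> nat \<Rightarrow> nat"
  proof (induction n)
    case (Suc n)
    let ?old = "{p. fst p < n \<and> snd p < n \<and> E (fst p) (snd p)}" and ?U = "{u. u < n \<and> E u n}"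
    have "{p. fst p < Suc n \<and> snd p < Suc n \<and> E (fst p) (snd p)} = ?old \<union> ((\<lambda>u. (u, n)) ` ?U \<union> (\<lambda>u. (n, u)) ` ?U)"
      using assms by (auto simp: less_Suc_eq image_iff)
    moreover have "finite ?old"
      by (rule finite_subset[of _ "{..<n} \<times> {..<n}"]) auto
    ultimately show ?case
      using Suc by (simp add: sum.union_disjoint sum.reindex inj_on_def sum.distrib disjoint_iff image_iff)
  qed simp
  then show ?thesis
    by (simp add: set_encode_image inj_prod_encode edge_code_def case_prod_unfold)
qed

lemma fixed_kinds_nth:
  assumes "0 < k"
  shows "fixed_kinds k ! 0 = Hub" "j < 2 \<Longrightarrow> fixed_kinds k ! (2 + j) = Satellite (Parity 0 j)" "4 \<le> path_start k"
proof -
  have "[0..<k] = 0 # [1..<k]"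
    using assms by (simp add: upt_conv_Cons)
  then have fixed: "fixed_kinds k =
      Hub # Satellite Clock # Satellite (Parity 0 0) # Satellite (Parity 0 1) # drop 4 (fixed_kinds k)"
    by (simp add: fixed_kinds_def core_kinds_def satellites_def)
  show "fixed_kinds k ! 0 = Hub"
    by (subst fixed) simp
  show "fixed_kinds k ! (2 + j) = Satellite (Parity 0 j)" if "j < 2"
    using that by (subst fixed) (auto simp: less_2_cases_iff)
  show "4 \<le> path_start k"
    unfolding path_start_def by (subst fixed) simp
qed

lemma lower_neighbours_path:
  assumes "0 < k"
  shows "{u. u < path_start k + Suc i \<and> linked (init_kind k u) (init_kind k (path_start k + Suc i))} =
    {0, 2 + Suc i mod 2, path_start k + i}"
proof (intro set_eqI)
  fix u
  have marks: "init_kind k 0 = Hub" "init_kind k (2 + Suc i mod 2) = Satellite (Parity 0 (Suc i mod 2))"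
      "2 + Suc i mod 2 < path_start k"
    using fixed_kinds_nth[OF assms] by (auto simp: init_kind_def)
  show "u \<in> {u. u < path_start k + Suc i \<and> linked (init_kind k u) (init_kind k (path_start k + Suc i))} \<longleftrightarrow>
      u \<in> {0, 2 + Suc i mod 2, path_start k + i}"
  proof (cases "u < path_start k")
    case True
    then have "init_kind k u \<in> set (fixed_kinds k)"
      by (simp add: init_kind_def path_start_def)
    then have "linked (init_kind k u) (Cell 0 (Suc i, 0)) \<longleftrightarrow>
        init_kind k u = Hub \<or> init_kind k u = Satellite (Parity 0 (Suc i mod 2))"
      by (auto simp: fixed_kinds_def set_core_kinds connector_kinds_def linked_def side_def)
    also have "\<dots> \<longleftrightarrow> u = 0 \<or> u = 2 + Suc i mod 2"
      using True marks init_kind_inj[of u k 0] by (auto simp: init_size_def)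
    finally show ?thesis
      using True by (simp del: add_Suc_right flip: add_Suc_right)
  next
    case False
    then obtain j where "u = path_start k + j"
      by (metis le_add_diff_inverse not_less)
    then show ?thesis
      using marks(3) by (auto simp: linked_def simp del: add_Suc_right)
  qed
qed

lemma status_init_kinds: "status (init_kinds k x) c (l, 0) = (if c = 0 \<and> l \<le> 4 * x then 1 else 0)"
  by (simp add: status.simps Cell_mem_init_kinds)

lemma label_of_init_kind:
  "label_of s (init_kinds k x) (init_kind k (path_start k + i)) =
    Cell_Label 0 False (i = 0) (if i \<le> 4 * x then 1 else 0) (i mod 4)"
  by (simp add: status_init_kinds)

lemma label_of_fixed_kind:
  assumes "v \<le> path_start k"
  shows "label_of s (init_kinds k x) (init_kind k v) = label_of s (init_kinds k 0) (init_kind k v)"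
proof (cases "v = path_start k")
  case True
  then show ?thesis
    using label_of_init_kind[of s k _ 0] by simp
next
  case False
  then have "v < init_size k 0"
    using assms by (simp add: init_size_def)
  then show ?thesis
    by (cases rule: init_kindE; cases "init_kind k v")
      (use assms False in \<open>auto simp: set_core_kinds status_init_kinds\<close>)
qed

subsection \<open>The code as an expression\<close>

definition pair_exp :: "exp \<Rightarrow> exp \<Rightarrow> exp" where
  "pair_exp a b = Add (Triangle (Add a b)) a"

fun list_exp :: "exp list \<Rightarrow> exp" where
  "list_exp [] = Const 0"
| "list_exp (e # es) = Add (pair_exp e (list_exp es)) (Const 1)"

definition node_exp :: "nat \<Rightarrow> exp \<Rightarrow> nat \<Rightarrow> exp" where
  "node_exp k j a = Add (Const (path_start k + a)) (Add (Add j j) (Add j j))"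

definition edge_exp :: "exp \<Rightarrow> exp \<Rightarrow> exp" where
  "edge_exp u v = Add (Pow2 (pair_exp u v)) (Pow2 (pair_exp v u))"

definition lower_edges_exp :: "nat \<Rightarrow> exp \<Rightarrow> nat \<Rightarrow> exp" where
  "lower_edges_exp k j a = (let v = node_exp k j (Suc a) in
     Add (edge_exp (Const 0) v) (Add (edge_exp (Const (2 + Suc a mod 2)) v) (edge_exp (node_exp k j a) v)))"

definition label_exp :: "nat \<Rightarrow> nat \<Rightarrow> exp \<Rightarrow> nat \<Rightarrow> exp" where
  "label_exp k n j a = Pow2 (pair_exp (node_exp k j (Suc a))
     (Const (to_nat (Cell_Label 0 False False n (Suc a mod 4)))))"

definition node_sum_exp :: "nat \<Rightarrow> (nat \<Rightarrow> exp) \<Rightarrow> exp \<Rightarrow> exp" where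
  "node_sum_exp n b e = Add (Const n) (Add (Sum (Add (Add (Add (b 0) (b 1)) (b 2)) (b 3))) e)"

definition nodes_exp :: "nat \<Rightarrow> exp" where
  "nodes_exp k = node_sum_exp (\<Sum>v<Suc (path_start k). 2 ^ v)
     (\<lambda>a. Pow2 (node_exp k Index (Suc a))) (Pow2 (node_exp k Input 1))"

definition edges_exp :: "nat \<Rightarrow> exp" where
  "edges_exp k = node_sum_exp
     (\<Sum>v<Suc (path_start k). \<Sum>u | u < v \<and> linked (init_kind k u) (init_kind k v). edge_code (u, v))
     (lower_edges_exp k Index) (lower_edges_exp k Input 0)"

definition with_token_exp :: "nat \<Rightarrow> nat \<Rightarrow> exp" where
  "with_token_exp k n = Add (Const (set_encode {..<n})) (Pow2 (node_exp k Input 0))"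

definition labels_exp :: "nat \<Rightarrow> exp" where
  "labels_exp k = node_sum_exp
     (\<Sum>v<Suc (path_start k). 2 ^ prod_encode (v, to_nat (label_of (At 0) (init_kinds k 0) (init_kind k v))))
     (label_exp k 1 Index) (label_exp k 0 Input 0)"

definition net_exp :: "nat \<Rightarrow> exp" where
  "net_exp k = list_exp [nodes_exp k, edges_exp k, with_token_exp k (path_start k),
     with_token_exp k (length (core_kinds k)), labels_exp k]"

lemma eval_pair_exp [simp]: "eval (pair_exp a b) x j = prod_encode (eval a x j, eval b x j)"
  by (simp add: pair_exp_def prod_encode_def)

lemma eval_node_exp [simp]: "eval (node_exp k i a) x j = path_start k + (4 * eval i x j + a)"
  by (simp add: node_exp_def)

lemma eval_edge_exp [simp]: "eval (edge_exp u v) x j = edge_code (eval u x j, eval v x j)"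
  by (simp add: edge_exp_def edge_code_def)

lemma eval_lower_edges_exp:
  assumes "0 < k" "i = 4 * eval e x j + a"
  shows "eval (lower_edges_exp k e a) x j =
    (\<Sum>u | u < path_start k + Suc i \<and> linked (init_kind k u) (init_kind k (path_start k + Suc i)).
      edge_code (u, path_start k + Suc i))"
proof -
  have "Suc i mod 2 = Suc a mod 2"
    unfolding assms(2) by presburger
  moreover have "0 \<noteq> 2 + Suc i mod 2" "path_start k + i \<noteq> 0" "2 + Suc i mod 2 \<noteq> path_start k + i"
    using fixed_kinds_nth(3)[OF assms(1)] mod_less_divisor[of 2 "Suc i"] by linarith+
  ultimately show ?thesis
    unfolding lower_neighbours_path[OF assms(1)] by (simp add: lower_edges_exp_def Let_def assms(2))
qed

lemma eval_label_exp:
  assumes "i = 4 * eval e x j + a"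
  shows "eval (label_exp k n e a) x j =
    2 ^ prod_encode (path_start k + Suc i, to_nat (Cell_Label 0 False False n (Suc i mod 4)))"
proof -
  have "Suc i mod 4 = Suc a mod 4"
    unfolding assms by presburger
  then show ?thesis
    by (simp add: label_exp_def assms)
qed

lemma eval_node_sum_exp:
  assumes "n = (\<Sum>v<Suc (path_start k). f v)"
    and "\<And>a i j. i = 4 * j + a \<Longrightarrow> i < 4 * x \<Longrightarrow> eval (b a) x j = f (path_start k + Suc i)"
    and "eval e x j = f (path_start k + Suc (4 * x))"
  shows "eval (node_sum_exp n b e) x j = (\<Sum>v<init_size k x. f v)"
proof -
  have "(\<Sum>j<x. eval (b 0) x j + eval (b 1) x j + eval (b 2) x j + eval (b 3) x j) =
      (\<Sum>i<4 * x. f (path_start k + Suc i))"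
    unfolding sum_blocks_of_4
    by (intro sum.cong refl arg_cong2[where f = "(+)"]; subst assms(2)) (auto simp: ac_simps)
  then show ?thesis
    unfolding sum_init_size by (simp add: node_sum_exp_def assms(1,3))
qed

lemma eval_nodes_exp: "eval (nodes_exp k) x j = set_encode (nodes (init_net k x))"
  unfolding nodes_exp_def init_net_simps set_encode_def by (rule eval_node_sum_exp) simp_all

lemma eval_edges_exp:
  assumes "0 < k"
  shows "eval (edges_exp k) x j = set_encode (prod_encode ` edges (init_net k x))"
  unfolding edges_exp_def init_net_simps
  by (subst set_encode_edges[OF linked_sym linked_irrefl], rule eval_node_sum_exp)
    (simp_all only: eval_lower_edges_exp[OF assms] eval.simps add_0_right)

lemma eval_with_token_exp:
  assumes "n \<le> path_start k"
  shows "eval (with_token_exp k n) x j = set_encode (insert (path_start k + 4 * x) {..<n})"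
  unfolding with_token_exp_def using assms by (subst set_encode_insert) auto

lemma eval_labels_exp:
  "eval (labels_exp k) x j = set_encode ((\<lambda>v. prod_encode (v, lab (init_net k x) v)) ` nodes (init_net k x))"
proof -
  let ?m = "path_start k" and ?label = "\<lambda>x v. to_nat (label_of (At 0) (init_kinds k x) (init_kind k v))"
  have "eval (labels_exp k) x j = (\<Sum>v<init_size k x. 2 ^ prod_encode (v, ?label x v))"
    unfolding labels_exp_def
  proof (rule eval_node_sum_exp)
    show "(\<Sum>v<Suc ?m. 2 ^ prod_encode (v, ?label 0 v)) = (\<Sum>v<Suc ?m. 2 ^ prod_encode (v, ?label x v))"
      by (intro sum.cong refl) (simp add: label_of_fixed_kind[of _ k _ x])
    show "eval (label_exp k 1 Index a) x j = 2 ^ prod_encode (?m + Suc i, ?label x (?m + Suc i))"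
      if "i = 4 * j + a" "i < 4 * x" for a i j
      using eval_label_exp[of i Index x j a k 1] that unfolding label_of_init_kind by simp
    show "eval (label_exp k 0 Input 0) x j = 2 ^ prod_encode (?m + Suc (4 * x), ?label x (?m + Suc (4 * x)))"
      using eval_label_exp[of "4 * x" Input x j 0 k 0] unfolding label_of_init_kind by simp
  qed
  also have "\<dots> = set_encode ((\<lambda>v. prod_encode (v, lab (init_net k x) v)) ` nodes (init_net k x))"
    by (subst set_encode_image) (auto simp: inj_on_def init_net_def)
  finally show ?thesis .
qed

lemma eval_net_exp:
  assumes "0 < k"
  shows "eval (net_exp k) x j = encode_network (init_net k x)"
proof -
  have "length (core_kinds k) \<le> path_start k"
    by (simp add: path_start_def fixed_kinds_def)
  then show ?thesis
    by (simp add: net_exp_def encode_network_def eval_nodes_exp eval_edges_exp[OF assms]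
        eval_with_token_exp eval_labels_exp del: init_net_simps(1,2) flip: init_net_simps(3,4))
qed

section \<open>Diagonalization\<close>

subsection \<open>The instance with a given rule list\<close>

definition instance_exp :: "nat \<Rightarrow> exp" where
  "instance_exp k = pair_exp (net_exp k) Input"

lemma exp_regs_instance_exp: "exp_regs (instance_exp k) = exp_regs (instance_exp 0)"
  by (simp add: instance_exp_def net_exp_def nodes_exp_def edges_exp_def with_token_exp_def labels_exp_def
      node_sum_exp_def lower_edges_exp_def label_exp_def edge_exp_def node_exp_def pair_exp_def Let_def)

definition instance_code :: "nat \<Rightarrow> nat \<Rightarrow> nat" where
  "instance_code k x = prod_encode (encode_network (init_net k x), x)"

definition quarter :: com where
  "quarter = LOOP 0 (INC 1 ;; DEC 0 ;; DEC 0 ;; DEC 0) ;; MOVE 1 0"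

definition prepare :: "nat \<Rightarrow> com" where
  "prepare k = quarter ;; exp_code (instance_exp k) 0 1 ;; CLEAR 0 2 ;; MOVE 1 0"

abbreviation input :: "nat \<Rightarrow> nat \<Rightarrow> nat" where
  "input x \<equiv> (\<lambda>_. 0)(0 := x)"

lemma exec_quarter: "exec quarter (input (4 * x)) (input x)"
  unfolding quarter_def
proof (rule exec_SEQ)
  have "exec (LOOP 0 (INC 1 ;; DEC 0 ;; DEC 0 ;; DEC 0)) (s(0 := 4 * x)) (s(0 := 0, 1 := s 1 + x))" for s
  proof (induction x arbitrary: s)
    case 0
    show ?case
      by (rule exec_eq[OF exec_LOOP_0]) (simp_all add: fun_eq_iff)
  next
    case (Suc x)
    show ?case
    proof (rule exec_LOOP_Suc)
      show "exec (INC 1 ;; DEC 0 ;; DEC 0 ;; DEC 0) ((s(0 := 4 * Suc x))(0 := (s(0 := 4 * Suc x)) 0 - 1))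
          ((s(1 := Suc (s 1)))(0 := 4 * x))"
        by (rule exec_eq[OF exec_SEQ[OF exec_INC exec_SEQ[OF exec_DEC exec_SEQ[OF exec_DEC exec_DEC]]]])
          (auto simp: fun_eq_iff)
      show "exec (LOOP 0 (INC 1 ;; DEC 0 ;; DEC 0 ;; DEC 0)) ((s(1 := Suc (s 1)))(0 := 4 * x))
          (s(0 := 0, 1 := s 1 + Suc x))"
        by (rule exec_eq[OF Suc.IH]) (auto simp: fun_eq_iff)
    qed simp
  qed
  then show "exec (LOOP 0 (INC 1 ;; DEC 0 ;; DEC 0 ;; DEC 0)) (input (4 * x)) ((\<lambda>_. 0)(1 := x))"
    by (rule exec_eq) (auto simp: fun_eq_iff)
  show "exec (MOVE 1 0) ((\<lambda>_. 0)(1 := x)) (input x)"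
    by (rule exec_eq[OF exec_MOVE]) (auto simp: fun_eq_iff)
qed

lemma exec_prepare:
  assumes "0 < k"
  shows "exec (prepare k) (input (4 * x)) (input (instance_code k x))"
proof -
  let ?h = "instance_code k x"
  have "eval (instance_exp k) x j = ?h" for j
    by (simp add: instance_exp_def instance_code_def eval_net_exp[OF assms])
  then have eval: "exec (exp_code (instance_exp k) 0 1) (input x) ((input x)(1 := ?h))"
    by (intro exec_eq[OF exec_exp_code]) auto
  have clear: "exec (CLEAR 0 2) ((input x)(1 := ?h)) ((\<lambda>_. 0)(1 := ?h))"
    by (rule exec_eq[OF exec_CLEAR]) (auto simp: fun_eq_iff)
  have move: "exec (MOVE 1 0) ((\<lambda>_. 0)(1 := ?h)) (input ?h)"
    by (rule exec_eq[OF exec_MOVE]) (auto simp: fun_eq_iff)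
  show ?thesis
    unfolding prepare_def by (rule exec_SEQ[OF exec_quarter exec_SEQ[OF eval exec_SEQ[OF clear move]]])
qed

lemma com_regs_prepare:
  assumes "2 < k" "1 + exp_regs (instance_exp 0) \<le> k"
  shows "com_regs (prepare k) \<subseteq> {..<k}"
  using com_regs_exp_code[of 0 1 "instance_exp k"] exp_regs_instance_exp[of k] assms
  by (auto simp: prepare_def quarter_def com_defs)

subsection \<open>The diagonal machine\<close>

definition relocate :: "nat \<Rightarrow> nat \<Rightarrow> nat \<Rightarrow> nat" where
  "relocate p n l = p + min l n"

fun relocate_instr :: "nat \<Rightarrow> nat \<Rightarrow> instr \<Rightarrow> instr" where
  "relocate_instr p n (Inc r l) = Inc r (relocate p n l)"
| "relocate_instr p n (Dec r l l') = Dec r (relocate p n l) (relocate p n l')"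

lemma instr_reg_relocate_instr [simp]: "instr_reg (relocate_instr p n i) = instr_reg i"
  by (cases i) auto

lemma reaches_relocated:
  assumes "embedded (map (relocate_instr p (length M)) M) p P"
  shows "reaches P (relocate p (length M) (fst c), snd c)
    (relocate p (length M) (fst (cm_run M t c)), snd (cm_run M t c))"
proof (induction t arbitrary: c)
  case 0
  show ?case by (simp add: reaches_refl)
next
  case (Suc t)
  obtain pc reg where conf: "c = (pc, reg)" by fastforce
  show ?case
  proof (cases "pc < length M")
    case True
    then have "P ! (p + pc) = relocate_instr p (length M) (M ! pc)" "p + pc < length P"
      using embedded_nth[OF assms, of pc] by simp_all
    then have "cm_step P (relocate p (length M) pc, reg) =
        (relocate p (length M) (fst (cm_step M c)), snd (cm_step M c))"
      using True by (cases "M ! pc") (auto simp: conf relocate_def[of p "length M" pc])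
    then show ?thesis
      using Suc[of "cm_step M c"] reaches_step unfolding cm_run_Suc by (metis conf fst_conv snd_conv)
  next
    case False
    then have "cm_step M c = c"
      by (simp add: conf)
    then show ?thesis
      using Suc[of c] by (simp add: cm_run_Suc)
  qed
qed

text \<open>The last instruction halts if the answer of \<open>M\<close> is 1 and loops if it is 0.\<close>
definition diagonal :: "com \<Rightarrow> cm_prog \<Rightarrow> cm_prog" where
  "diagonal c M = (let p = com_len c; e = p + length M in
     com_code c 0 p @ map (relocate_instr p (length M)) M @ [Dec 0 (Suc e) e])"

lemma instr_reg_diagonal: "instr_reg ` set (diagonal c M) = com_regs c \<union> instr_reg ` set M \<union> {0}"
  by (auto simp: diagonal_def Let_def image_Un image_image instr_reg_com_code)

lemma halts_diagonal_iff:
  assumes "exec c (input z) (input h)" "cm_answers M h b"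
  shows "halts (diagonal c M) (cm_init z) \<longleftrightarrow> b"
proof -
  let ?P = "diagonal c M" and ?p = "com_len c"
  let ?e = "?p + length M"
  obtain t where outcome: "cm_halted M (cm_run M t (cm_init h))" "snd (cm_run M t (cm_init h)) 0 = of_bool b"
    using assms(2) by (auto simp: cm_answers_def)
  define reg where "reg = snd (cm_run M t (cm_init h))"
  have segments: "embedded (com_code c 0 ?p) 0 ?P" "embedded (map (relocate_instr ?p (length M)) M) ?p ?P"
    and last: "?P ! ?e = Dec 0 (Suc ?e) ?e" "length ?P = Suc ?e"
    using embedded_middle[of "com_code c 0 ?p" "[]"] embedded_middle[of _ "com_code c 0 ?p"]
    by (simp_all add: diagonal_def Let_def nth_append)
  have "reaches ?P (cm_init z) (?p, input h)"
    using reaches_com_code[OF assms(1) segments(1)] by (simp add: cm_init_def)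
  also have "reaches ?P (?p, input h) (?e, reg)"
    using reaches_relocated[OF segments(2), of "cm_init h" t] outcome(1)
    by (simp add: relocate_def cm_init_def cm_halted_def reg_def)
  finally have "halts ?P (cm_init z) \<longleftrightarrow> halts ?P (?e, reg)"
    using halts_reaches by blast
  also have "\<dots> \<longleftrightarrow> b"
  proof (cases b)
    case True
    then have "cm_step ?P (?e, reg) = (Suc ?e, reg(0 := reg 0 - 1))"
      using outcome(2) last by (simp add: reg_def)
    then have "cm_halted ?P (cm_run ?P 1 (?e, reg))"
      by (simp add: cm_run_Suc cm_halted_def last)
    then show ?thesis
      using True by (auto simp: halts_def)
  next
    case False
    then have "cm_step ?P (?e, reg) = (?e, reg)"
      using outcome(2) last by (simp add: reg_def)
    then have "cm_run ?P j (?e, reg) = (?e, reg)" for j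
      by (induction j) (auto simp: cm_run_Suc)
    then show ?thesis
      using False by (simp add: halts_def cm_halted_def last)
  qed
  finally show ?thesis .
qed

lemma ex_register_bound:
  obtains k where "2 < k" "1 + exp_regs (instance_exp 0) \<le> k" "instr_reg ` set M \<subseteq> {..<k}"
proof -
  obtain n where "instr_reg ` set M \<subseteq> {..<n}"
    using finite_nat_set_iff_bounded[of "instr_reg ` set M"] by auto
  then show thesis
    by (intro that[of "n + exp_regs (instance_exp 0) + 3"]) auto
qed

lemma no_weak_decider:
  assumes decides: "\<And>G R. safety_instance G R \<Longrightarrow> (\<forall>r\<in>set R. \<not> is_strong_creation r) \<Longrightarrow>
    cm_answers M (encode_instance G R) (constructor_wins_safety G R)"
  shows False
proof -
  obtain k where registers: "2 < k" "1 + exp_regs (instance_exp 0) \<le> k" "instr_reg ` set M \<subseteq> {..<k}"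
    by (rule ex_register_bound)
  define P where "P = diagonal (prepare k) M"
  define R where "R = game_rules P k"
  define x where "x = list_encode (map encode_rule R)"
  have "instr_reg ` set P \<subseteq> {..<k}"
    using com_regs_prepare[OF registers(1,2)] registers(1,3) by (simp add: P_def instr_reg_diagonal)
  then have "constructor_wins_safety (init_net k x) R \<longleftrightarrow> \<not> halts P (cm_init (4 * x))"
    unfolding R_def using registers(1) by (intro constructor_wins_init_net_iff) auto
  moreover have "cm_answers M (encode_instance (init_net k x) R) (constructor_wins_safety (init_net k x) R)"
    using init_safety_instance game_rules_weak registers(1) by (intro decides) (auto simp: R_def)
  then have "cm_answers M (instance_code k x) (constructor_wins_safety (init_net k x) R)"
    by (simp add: encode_instance_def instance_code_def x_def)
  then have "halts P (cm_init (4 * x)) \<longleftrightarrow> constructor_wins_safety (init_net k x) R"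
    unfolding P_def using registers(1) by (intro halts_diagonal_iff[OF exec_prepare]) auto
  ultimately show False by blast
qed

theorem theorem1:
  shows "(\<nexists>M. \<forall>G R. safety_instance G R \<longrightarrow>
            cm_answers M (encode_instance G R) (constructor_wins_safety G R))
       \<and> (\<nexists>M. \<forall>G R. safety_instance G R \<and> (\<forall>r\<in>set R. \<not> is_strong_creation r) \<longrightarrow>
            cm_answers M (encode_instance G R) (constructor_wins_safety G R))"
  using no_weak_decider by blast

end
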